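(* Let $r\ge 1$ be an integer. The function $\zeta^2(s)\zeta^2(2s)\zeta^2(3s)\cdots\zeta^2(rs)$ generates the direct factors of finite abelian groups whose conjugates have rank at most $r$; that is, for $\Re(s)>1$, $$\zeta^2(s)\zeta^2(2s)\cdots\zeta^2(rs)=\sum_{n=1}^\infty d_r(n)\,n^{-s},$$ where $d_r(n)$ is the sum, over isomorphism classes of abelian groups $G$ of order $n$ whose conjugate $G'$ has rank at most $r$, of the number of direct factors of $G$.
   Context: $\zeta$ is the Riemann zeta function. Groups are considered up to isomorphism. The number of direct factors of a finite abelian group $G$ is the number of ordered pairs $(H,K)$ of isomorphism classes of finite abelian groups with $G\cong H\oplus K$ (since $H$ determines $K$ up to isomorphism, this is the number of isomorphism classes of $H$ that are direct factors of $G$). The rank of a finite abelian group is its minimal number of generators. Conjugate group: for a prime $p$ and a finite abelian $p$-group $G\cong \mathbb Z/p^{a_1}\mathbb Z\oplus\cdots\oplus\mathbb Z/p^{a_r}\mathbb Z$ with $0\le a_1\le\cdots\le a_r$, the type of $G$ is the partition $\lambda=(a_1,\dots,a_r)$, and the conjugate $G'$ is the finite abelian $p$-group whose type is the conjugate (transposed) partition $\lambda'$. For a general finite abelian group, $G'$ is the direct sum of the conjugates of its $p$-primary components. *)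

theory Defs
  imports
    "HOL-Analysis.Analysis"
    "HOL-Computational_Algebra.Primes"
    "HOL-Algebra.Product_Groups"
begin

text \<open>
  The Riemann zeta function on the half-plane \<open>Re s > 1\<close>, where it is given by its Dirichlet
  series. The definition is not meant to be used outside this half-plane.
\<close>

definition riemann_zeta :: "complex \<Rightarrow> complex" where
  "riemann_zeta s = (\<Sum>n. of_nat (Suc n) powr (-s))"


text \<open>
  Every finite group is isomorphic to one whose carrier is a set of natural numbers, so the
  isomorphism classes of finite abelian groups are taken among the groups of type
  \<^typ>\<open>nat monoid\<close>.
\<close>

definition fin_ab_groups :: "nat monoid set" where
  "fin_ab_groups = {G. comm_group G \<and> finite (carrier G)}"

definition fin_ab_iso :: "(nat monoid \<times> nat monoid) set" where
  "fin_ab_iso = {(G, H). G \<in> fin_ab_groups \<and> H \<in> fin_ab_groups \<and> G \<cong> H}"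

definition fin_ab_classes :: "nat monoid set set" where
  "fin_ab_classes = fin_ab_groups // fin_ab_iso"

definition representative :: "nat monoid set \<Rightarrow> nat monoid" where
  "representative C = (SOME G. G \<in> C)"

definition num_direct_factors :: "('a, 'b) monoid_scheme \<Rightarrow> nat" where
  "num_direct_factors G =
     card {(A, B). A \<in> fin_ab_classes \<and> B \<in> fin_ab_classes \<and>
                   G \<cong> representative A \<times>\<times> representative B}"

definition group_rank :: "('a, 'b) monoid_scheme \<Rightarrow> nat" where
  "group_rank G =
     (LEAST k. \<exists>S. S \<subseteq> carrier G \<and> finite S \<and> card S = k \<and> generate G S = carrier G)"


text \<open>
  Partitions are nondecreasing lists of positive integers. The parts of the conjugate partition
  are the numbers of parts of size at least \<open>j\<close>, for \<open>j\<close> from \<open>1\<close> to the largest part; they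
  decrease with \<open>j\<close>, whence the reversal.
\<close>

definition is_partition :: "nat list \<Rightarrow> bool" where
  "is_partition as \<longleftrightarrow> sorted as \<and> (\<forall>a\<in>set as. 0 < a)"

definition conjugate_partition :: "nat list \<Rightarrow> nat list" where
  "conjugate_partition as =
     rev (map (\<lambda>j. length (filter (\<lambda>a. j \<le> a) as)) [1..<Suc (Max (insert 0 (set as)))])"

definition group_of_type :: "nat \<Rightarrow> nat list \<Rightarrow> (nat \<Rightarrow> int) monoid" where
  "group_of_type p as = product_group {..<length as} (\<lambda>i. integer_mod_group (p ^ (as ! i)))"

definition type_of_p_group :: "nat \<Rightarrow> ('a, 'b) monoid_scheme \<Rightarrow> nat list" where
  "type_of_p_group p G = (THE as. is_partition as \<and> G \<cong> group_of_type p as)"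

definition conjugate_p_group :: "nat \<Rightarrow> ('a, 'b) monoid_scheme \<Rightarrow> (nat \<Rightarrow> int) monoid" where
  "conjugate_p_group p G = group_of_type p (conjugate_partition (type_of_p_group p G))"

definition primary_component ::
    "nat \<Rightarrow> ('a, 'b) monoid_scheme \<Rightarrow> ('a, 'b) monoid_scheme" where
  "primary_component p G = G\<lparr>carrier := {x \<in> carrier G. \<exists>k::nat. x [^]\<^bsub>G\<^esub> (p ^ k) = \<one>\<^bsub>G\<^esub>}\<rparr>"

text \<open>
  The direct sum in the conjugate is over finitely many primes, so it is a direct product; the
  primary components at all other primes are trivial.
\<close>

definition conjugate_group :: "('a, 'b) monoid_scheme \<Rightarrow> (nat \<Rightarrow> nat \<Rightarrow> int) monoid" where
  "conjugate_group G =
     product_group {p. prime p \<and> p dvd order G}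
       (\<lambda>p. conjugate_p_group p (primary_component p G))"


definition direct_factor_sum :: "nat \<Rightarrow> nat \<Rightarrow> nat" where
  "direct_factor_sum r n =
     (\<Sum>C \<in> {C \<in> fin_ab_classes. order (representative C) = n \<and>
                group_rank (conjugate_group (representative C)) \<le> r}.
        num_direct_factors (representative C))"

end

theory Submission
  imports Defs "HOL-Algebra.Multiplicative_Group" "HOL-Number_Theory.Cong"
begin

text \<open>
  The conjugate of a partition \<open>\<lambda>\<close> has as many parts as the largest part of \<open>\<lambda>\<close>, so the rank of
  \<open>G'\<close> is at most \<open>r\<close> iff every cyclic primary summand of \<open>G\<close> has order \<open>p ^ k\<close> with \<open>k \<le> r\<close>; and
  this holds for a direct product iff it holds for both factors. Grouping the summands by their
  exponent \<open>k\<close> and collecting in \<open>g k\<close> the product of the primes \<open>p\<close> that occur, such groups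
  correspond to arbitrary tuples \<open>(g 1, \<dots>, g r)\<close> of positive integers, the order being
  \<open>\<Prod>k. g k ^ k\<close>. Thus \<open>\<zeta>(s) \<zeta>(2s) \<cdots> \<zeta>(rs)\<close> is their generating Dirichlet series, and a pair
  consisting of a group and a decomposition of it is a pair of tuples, whence the square.
\<close>

section \<open>Splitting off a cyclic primary subgroup\<close>

text \<open>The correspondence with tuples has to be onto and one-to-one on isomorphism classes, so
  both halves of the structure theorem are needed. Existence splits off the cyclic group of an
  element of maximal \<open>p\<close>-power order. Uniqueness counts the solutions of
  \<open>x ^ (p ^ t) = 1\<close>: their number is a power of \<open>p\<close> whose exponent is the
  sum of \<open>min k t\<close> over the summands of order \<open>p ^ k\<close>, and its second
  differences in \<open>t\<close> recover how many summands have each order. The rank of the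
  conjugate is hard to follow through products and changes of representative. It is therefore
  replaced by a condition on powers of elements, \<open>primary_exponents_le\<close>. For the rank
  itself, the lower bound counts homomorphisms to \<int>/p, and the upper bound lets one generator
  serve all primes by the Chinese remainder theorem. The square appears without multiplicities
  because every ordered pair of classes is a decomposition of exactly one class, that of the
  product. Absolute convergence then permits sorting the pairs by order.\<close>

lemma (in comm_group) subgroup_adjoin_powers:
  assumes "subgroup K G" "a \<in> carrier G"
  shows "subgroup {k \<otimes> a [^] i |k (i::int). k \<in> K} G"
proof (rule subgroupI)
  have K: "K \<subseteq> carrier G" using assms(1) subgroup.subset by blast
  show "{k \<otimes> a [^] i |k (i::int). k \<in> K} \<subseteq> carrier G" using K assms(2) by auto
  show "{k \<otimes> a [^] i |k (i::int). k \<in> K} \<noteq> {}" using subgroup.one_closed[OF assms(1)] by auto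
next
  fix x assume "x \<in> {k \<otimes> a [^] i |k (i::int). k \<in> K}"
  then obtain k and i :: int where x: "x = k \<otimes> a [^] i" "k \<in> K" by blast
  have k: "k \<in> carrier G" using assms(1) x(2) subgroup.mem_carrier by fastforce
  have "inv x = inv k \<otimes> a [^] (-i)" using x k assms(2) by (simp add: inv_mult int_pow_neg)
  then show "inv x \<in> {k \<otimes> a [^] i |k (i::int). k \<in> K}"
    using subgroup.m_inv_closed[OF assms(1) x(2)] by blast
next
  fix x y assume "x \<in> {k \<otimes> a [^] i |k (i::int). k \<in> K}" "y \<in> {k \<otimes> a [^] i |k (i::int). k \<in> K}"
  then obtain k l and i j :: int where x: "x = k \<otimes> a [^] i" "k \<in> K" "y = l \<otimes> a [^] j" "l \<in> K" by blast
  have k: "k \<in> carrier G" "l \<in> carrier G" using assms(1) x(2,4) subgroup.mem_carrier by fastforce+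
  have "x \<otimes> y = (k \<otimes> l) \<otimes> a [^] (i + j)" using x k assms(2) by (simp add: int_pow_mult m_ac)
  then show "x \<otimes> y \<in> {k \<otimes> a [^] i |k (i::int). k \<in> K}"
    using subgroup.m_closed[OF assms(1) x(2,4)] by blast
qed

text \<open>The least positive \<open>n\<close> with \<open>x ^ n\<close> in \<open>H\<close>
  exceeds 1. For a prime \<open>q\<close> dividing it, minimality keeps \<open>x ^ (n div q)\<close>
  outside \<open>H\<close>, while the \<open>q\<close>-th power of that element is
  \<open>x ^ n\<close>.\<close>

lemma (in group) least_power_in_subgroup:
  assumes "finite (carrier G)" "subgroup H G" "x \<in> carrier G" "x \<notin> H"
  obtains y q where "y \<in> carrier G" "y \<notin> H" "prime (q::nat)" "y [^] q \<in> H"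
proof -
  define n where "n = (LEAST n::nat. n > 0 \<and> x [^] n \<in> H)"
  have "ord x > 0 \<and> x [^] ord x \<in> H"
    using assms ord_ge_1[of x] subgroup.one_closed by fastforce
  then have n: "n > 0" "x [^] n \<in> H"
    unfolding n_def by (rule LeastI2; blast)+
  have "n \<noteq> 1" using n assms by auto
  then obtain q where q: "prime q" "q dvd n" using prime_factor_nat by blast
  have "n div q < n" "n div q > 0" using q n prime_gt_1_nat[of q]
    by (auto simp: div_greater_zero_iff dest: dvd_imp_le)
  then have "x [^] (n div q) \<notin> H" using not_less_Least[of "n div q" "\<lambda>n. n > 0 \<and> x [^] n \<in> H"]
    unfolding n_def by blast
  moreover have "(x [^] (n div q)) [^] q \<in> H" using n q assms by (simp add: nat_pow_pow)
  ultimately show ?thesis using that q assms by blast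
qed

text \<open>Choose \<open>a\<close> of the largest order among the powers of one prime
  \<open>p\<close>, and \<open>K\<close> maximal among the subgroups meeting the span of
  \<open>a\<close> trivially. The maximal order makes the \<open>a\<close>-part of certain elements
  divisible by \<open>p\<close>, which is what forces \<open>K\<close> and \<open>a\<close> to span
  the group.\<close>

lemma (in comm_group) cyclic_primary_complement:
  assumes fin: "finite (carrier G)" and nt: "carrier G \<noteq> {\<one>}"
  obtains a K p e where "a \<in> carrier G" "subgroup K G" "prime (p::nat)" "e \<ge> (1::nat)" "ord a = p ^ e"
    "\<And>x. x \<in> carrier G \<Longrightarrow> \<exists>k\<in>K. \<exists>i::int. x = k \<otimes> a [^] i"
    "\<And>i::int. a [^] i \<in> K \<Longrightarrow> int (p ^ e) dvd i"
proof -
  obtain b where b: "b \<in> carrier G" "b \<noteq> \<one>" using nt one_closed by blast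
  \<comment> \<open>The trivial subgroup in the role of \<open>H\<close> yields an element of prime
    order, and this selects \<open>p\<close>.\<close>
  obtain y p where y: "y \<in> carrier G" "y \<noteq> \<one>" "prime (p::nat)" "y [^] p = \<one>"
    using least_power_in_subgroup[OF fin triv_subgroup b(1)] b(2) by blast
  have ordy: "ord y = p" using y by (metis dvd_refl ord_eq_1 pow_eq_id prime_nat_iff)
  define E where "E = {e. \<exists>a\<in>carrier G. ord a = p ^ e}"
  have "inj (\<lambda>e. p ^ e)" using y(3) prime_gt_1_nat by (auto intro!: injI simp: power_inject_exp)
  moreover have "(\<lambda>e. p ^ e) ` E \<subseteq> ord ` carrier G" unfolding E_def by (auto simp: image_iff) metis
  ultimately have finE: "finite E" using fin
    by (meson finite_imageD finite_imageI finite_subset inj_on_subset subset_UNIV)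
  have E1: "1 \<in> E" using ordy y(1) unfolding E_def by force
  define e where "e = Max E"
  have e1: "e \<ge> 1" unfolding e_def using finE E1 by simp
  have "e \<in> E" unfolding e_def using finE E1 Max_in by blast
  then obtain a where a: "a \<in> carrier G" "ord a = p ^ e" unfolding E_def by blast
  \<comment> \<open>All \<open>p\<close>-power orders divide the largest one, so a single exponent
    \<open>p ^ e\<close> kills every \<open>p\<close>-primary element.\<close>
  have emax: "z [^] (p ^ e) = \<one>" if z: "z \<in> carrier G" "z [^] (p ^ f) = \<one>" for z f
  proof -
    have "ord z dvd p ^ f" using z pow_eq_id by simp
    then obtain g where g: "ord z = p ^ g" using divides_primepow_nat y(3) by blast
    then have "g \<in> E" using z unfolding E_def by blast
    then have "g \<le> e" unfolding e_def using finE by simp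
    then show ?thesis using z g pow_eq_id le_imp_power_dvd by simp
  qed
  \<comment> \<open>As \<open>ord a = p ^ e\<close>, the divisibility says that \<open>K\<close>
    meets the span of \<open>a\<close> only in the identity.\<close>
  define S where "S = {K. subgroup K G \<and> (\<forall>i::int. a [^] i \<in> K \<longrightarrow> int (p ^ e) dvd i)}"
  have "S \<subseteq> Pow (carrier G)" unfolding S_def using subgroup.subset by blast
  then have finS: "finite S" using fin finite_subset by blast
  have "{\<one>} \<in> S" unfolding S_def using triv_subgroup a int_pow_eq_id by auto
  then obtain K where K: "K \<in> S" and Kmax: "\<And>K'. K' \<in> S \<Longrightarrow> K \<subseteq> K' \<Longrightarrow> K' = K"
    using finite_has_maximal[OF finS] by blast
  have sK: "subgroup K G" and Ka: "\<And>i::int. a [^] i \<in> K \<Longrightarrow> int (p ^ e) dvd i" using K unfolding S_def by auto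
  have Kc: "\<And>k. k \<in> K \<Longrightarrow> k \<in> carrier G" using sK subgroup.mem_carrier by fastforce
  define H where "H = {k \<otimes> a [^] i |k (i::int). k \<in> K}"
  have sH: "subgroup H G" unfolding H_def using subgroup_adjoin_powers sK a by blast
  have KH: "k \<in> H" if "k \<in> K" for k unfolding H_def using that Kc
    by (auto intro!: exI[of _ k] exI[of _ "0::int"])
  have aH: "a [^] (i::int) \<in> H" for i unfolding H_def using a subgroup.one_closed[OF sK]
    by (auto intro!: exI[of _ \<one>] exI[of _ i])
  \<comment> \<open>If \<open>H = K\<langle>a\<rangle>\<close> were proper, some \<open>z \<notin> H\<close> would have a prime power \<open>z ^ q\<close> in \<open>K\<close>;
    then \<open>K\<langle>z\<rangle>\<close> contradicts the maximality of \<open>K\<close>.\<close>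
  have "x \<in> H" if xc: "x \<in> carrier G" for x
  proof (rule ccontr)
    assume "x \<notin> H"
    then obtain y q where y: "y \<in> carrier G" "y \<notin> H" "prime (q::nat)" "y [^] q \<in> H"
      using least_power_in_subgroup[OF fin sH xc] by metis
    obtain k and m :: int where km: "y [^] q = k \<otimes> a [^] m" "k \<in> K" using y(4) unfolding H_def by blast
    have kc: "k \<in> carrier G" using km Kc by blast
    \<comment> \<open>Once the \<open>a\<close>-part of \<open>y ^ q\<close> is itself a
      \<open>q\<close>-th power, it can be divided out of \<open>y\<close>: the element
      \<open>z = y a ^ (-m')\<close> has \<open>z ^ q = k\<close> in \<open>K\<close>.\<close>
    obtain m' :: int where m': "a [^] m = a [^] (m' * int q)"
    proof (cases "q = p")
      case True
      \<comment> \<open>\<open>p\<close> divides \<open>m\<close>, because \<open>p ^ e\<close> kills the \<open>p\<close>-part \<open>y ^ t\<close> of \<open>y\<close>.\<close>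
      define N where "N = ord y"
      have N: "N > 0" "y [^] N = \<one>" unfolding N_def using y ord_ge_1 fin by (auto simp: Suc_le_eq)
      obtain t f where tf: "N = p ^ f * t" "\<not> p dvd t"
        using N \<open>prime p\<close> multiplicity_decompose'[of N p]
        by (metis bot_nat_0.not_eq_extremum not_prime_unit)
      have "(y [^] t) [^] (p ^ f) = \<one>" using N tf y by (simp add: nat_pow_pow mult.commute)
      then have "(y [^] t) [^] (p ^ e) = \<one>" using emax y by blast
      \<comment> \<open>One factor \<open>p\<close> of \<open>p ^ e\<close> moves into
        \<open>y ^ q\<close>, which is \<open>k a ^ m\<close>. The result puts
        \<open>a ^ (m t p ^ (e - 1))\<close> in \<open>K\<close>, so \<open>p\<close> divides
        \<open>m t\<close>, and \<open>t\<close> is prime to \<open>p\<close>.\<close>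
      moreover have "(y [^] t) [^] (p ^ e) = (y [^] q) [^] (t * p ^ (e - 1))"
        using y e1 True by (simp add: nat_pow_pow mult_ac power_eq_if)
      also have "\<dots> = k [^] (t * p ^ (e - 1)) \<otimes> a [^] (m * int (t * p ^ (e - 1)))"
        unfolding km(1) using kc a
        by (simp add: int_pow_distrib int_pow_pow flip: int_pow_int)
      finally have "k [^] (t * p ^ (e - 1)) \<otimes> a [^] (m * int (t * p ^ (e - 1))) = \<one>" by simp
      then have "a [^] (m * int (t * p ^ (e - 1))) = inv (k [^] (t * p ^ (e - 1)))"
        using kc a by (metis int_pow_closed inv_equality inv_inv nat_pow_closed m_comm)
      also have "\<dots> \<in> K" using km(2) sK
        by (metis group.subgroup_int_pow_closed int_pow_int is_group subgroup.m_inv_closed)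
      finally have "int (p ^ e) dvd m * int (t * p ^ (e - 1))" using Ka by blast
      moreover have "int (p ^ e) = int p * int (p ^ (e - 1))" using e1 by (simp add: power_eq_if)
      ultimately have "int p * int (p ^ (e - 1)) dvd (m * int t) * int (p ^ (e - 1))"
        by (simp add: mult_ac)
      then have "int p dvd m * int t" using \<open>prime p\<close> by (simp add: prime_gt_0_nat)
      then have "int p dvd m" using tf(2) \<open>prime p\<close> prime_dvd_mult_iff[of "int p" m "int t"] by simp
      then obtain m' where "m = m' * int q" using True by (metis dvd_div_mult_self)
      then show ?thesis using that by blast
    next
      case False
      \<comment> \<open>Here \<open>q\<close> is invertible modulo the order of \<open>a\<close>;
        with inverse \<open>u\<close>, the choice is \<open>m' = m u\<close>.\<close>
      then have "coprime (int q) (int (p ^ e))" using y(3) \<open>prime p\<close>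
        by (simp add: primes_coprime)
      then obtain u v where uv: "u * int q + v * int (p ^ e) = 1"
        by (metis bezout_int coprime_imp_gcd_eq_1)
      have "m - (m * u) * int q = m * v * int (p ^ e)" using uv
        by (metis (no_types, lifting) add_diff_cancel_left' mult.assoc mult.right_neutral distrib_left)
      then have "a [^] m = a [^] ((m * u) * int q)" using a int_pow_eq[of a m "(m*u) * int q"]
        by (metis dvd_triv_right dvd_diff_commute)
      then show ?thesis using that by blast
    qed
    define z where "z = y \<otimes> a [^] (- m')"
    have zc: "z \<in> carrier G" unfolding z_def using y a by simp
    have zy: "y = z \<otimes> a [^] m'" unfolding z_def using y a by (simp add: m_assoc flip: int_pow_mult)
    have zH: "z \<notin> H" using zy y(2) aH subgroup.m_closed[OF sH] by metis
    have "z [^] q = (y [^] q) \<otimes> a [^] (- m' * int q)"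
      unfolding z_def using y a by (simp add: int_pow_distrib int_pow_pow flip: int_pow_int)
    also have "\<dots> = k" unfolding km(1) m' using a kc by (simp add: m_assoc flip: int_pow_mult)
    finally have zq: "z [^] q \<in> K" using km by simp
    define K' where "K' = {k \<otimes> z [^] i |k (i::int). k \<in> K}"
    have sK': "subgroup K' G" unfolding K'_def using subgroup_adjoin_powers sK zc by blast
    have "K \<subseteq> K'" unfolding K'_def using Kc by (force intro!: exI[of _ "0::int"])
    moreover have "z \<in> K'" unfolding K'_def using zc subgroup.one_closed[OF sK]
      by (auto intro!: exI[of _ \<one>] exI[of _ "1::int"])
    moreover have "z \<notin> K" using zH KH by blast
    ultimately have "K' \<notin> S" using Kmax by blast
    then obtain j :: int where j: "a [^] j \<in> K'" "\<not> int (p ^ e) dvd j" using sK' unfolding S_def by blast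
    obtain k' and i :: int where k': "a [^] j = k' \<otimes> z [^] i" "k' \<in> K" using j(1) unfolding K'_def by blast
    have zi: "z [^] i = inv k' \<otimes> a [^] j" using k' Kc zc a by (simp flip: m_assoc)
    have ziH: "z [^] i \<in> H" unfolding zi
      using subgroup.m_closed[OF sH] aH KH subgroup.m_inv_closed[OF sK k'(2)] by blast
    have zqpow: "z [^] (int q * w) \<in> K" for w :: int
      using zq subgroup_int_pow_closed[OF sK zq, of w] zc by (simp add: int_pow_pow flip: int_pow_int)
    \<comment> \<open>If \<open>q\<close> divided \<open>i\<close>, then \<open>z ^ i\<close>, and
      with it \<open>a ^ j\<close>, would lie in \<open>K\<close>. Otherwise a Bezout relation
      writes \<open>z\<close> through \<open>z ^ i\<close> and \<open>z ^ q\<close>, both in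
      \<open>H\<close>, against the choice of \<open>z\<close>.\<close>
    have "\<not> int q dvd i"
    proof
      assume "int q dvd i"
      then have "z [^] i \<in> K" using zqpow by (auto elim: dvdE)
      then have "a [^] j \<in> K" using k' subgroup.m_closed[OF sK] by simp
      then show False using Ka j(2) by blast
    qed
    then have "coprime i (int q)" using y(3) by (metis coprime_commute prime_imp_coprime prime_nat_int_transfer)
    then obtain u v where uv: "u * i + v * int q = 1" by (metis bezout_int coprime_imp_gcd_eq_1)
    have "z = z [^] (u * i + v * int q)" unfolding uv using zc by simp
    also have "\<dots> = (z [^] i) [^] u \<otimes> z [^] (int q * v)" using zc by (simp add: int_pow_mult int_pow_pow mult.commute)
    also have "\<dots> \<in> H" using subgroup.m_closed[OF sH] subgroup_int_pow_closed[OF sH ziH] KH zqpow by blast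
    finally show False using zH by blast
  qed
  then have "\<exists>k\<in>K. \<exists>i::int. x = k \<otimes> a [^] i" if "x \<in> carrier G" for x using that unfolding H_def by blast
  then show ?thesis using that[of a K p e] a sK \<open>prime p\<close> e1 Ka by blast
qed

section \<open>Products of cyclic primary groups\<close>

text \<open>The index set is arbitrary so that the same lemmas serve initial segments of the
  naturals, positions in a list and the triples of \<open>model_index\<close>.\<close>

definition primary_product :: "'i set \<Rightarrow> ('i \<Rightarrow> nat) \<Rightarrow> ('i \<Rightarrow> nat) \<Rightarrow> ('i \<Rightarrow> int) monoid" where
  "primary_product J \<pi> \<kappa> = product_group J (\<lambda>j. integer_mod_group (\<pi> j ^ \<kappa> j))"

lemma comm_group_primary_product: "comm_group (primary_product J \<pi> \<kappa>)"
  unfolding primary_product_def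
  by (rule group.group_comm_groupI) (auto simp: add.commute)

text \<open>Primality makes each modulus positive; \<open>integer_mod_group 0\<close> would be the
  infinite cyclic group.\<close>

lemma carrier_primary_product:
  assumes "\<And>j. j \<in> J \<Longrightarrow> prime (\<pi> j)"
  shows "carrier (primary_product J \<pi> \<kappa>) = (\<Pi>\<^sub>E j\<in>J. {0..<int (\<pi> j ^ \<kappa> j)})"
  unfolding primary_product_def
  by (auto simp: carrier_integer_mod_group intro!: PiE_cong dest!: assms)

lemma one_primary_product: "\<one>\<^bsub>primary_product J \<pi> \<kappa>\<^esub> = (\<lambda>j\<in>J. 0)"
  by (simp add: primary_product_def)

lemma mult_primary_product:
  "x \<otimes>\<^bsub>primary_product J \<pi> \<kappa>\<^esub> y = (\<lambda>j\<in>J. (x j + y j) mod int (\<pi> j ^ \<kappa> j))"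
  by (simp add: primary_product_def)

lemma pow_primary_product:
  fixes n :: nat
  shows "x [^]\<^bsub>primary_product J \<pi> \<kappa>\<^esub> n = (\<lambda>j\<in>J. (int n * x j) mod int (\<pi> j ^ \<kappa> j))"
  by (induction n) (auto simp: one_primary_product mult_primary_product mod_simps algebra_simps intro!: restrict_ext)

lemma finite_primary_product:
  assumes "finite J" "\<And>j. j \<in> J \<Longrightarrow> prime (\<pi> j)"
  shows "finite (carrier (primary_product J \<pi> \<kappa>))"
  using assms by (simp add: carrier_primary_product finite_PiE)

lemma order_primary_product:
  assumes "finite J" "\<And>j. j \<in> J \<Longrightarrow> prime (\<pi> j)"
  shows "order (primary_product J \<pi> \<kappa>) = (\<Prod>j\<in>J. \<pi> j ^ \<kappa> j)"
  using assms by (simp add: order_def carrier_primary_product card_PiE flip: of_nat_power)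

section \<open>Torsion counts and the uniqueness of the multiplicities\<close>

lemma card_annihilated_residues:
  fixes p q :: nat
  assumes "prime p" "prime q"
  shows "card {y \<in> {0..<int (q ^ k)}. (int (p ^ t) * y) mod int (q ^ k) = 0} = (if q = p then p ^ min k t else 1)"
proof (cases "q = p")
  case True
  define A where "A = int (p ^ (k - min k t))"
  define m where "m = int (p ^ min k t)"
  define B where "B = int (p ^ (t - min k t))"
  have p0: "p > 0" using assms prime_gt_0_nat by blast
  have pos: "A > 0" "m > 0" unfolding A_def m_def using p0 by auto
  have qk: "int (q ^ k) = m * A" and pt: "int (p ^ t) = m * B"
    unfolding A_def m_def B_def True by (simp_all flip: power_add)
  \<comment> \<open>\<open>A\<close> and \<open>B\<close> are what remains of the two prime powers
    after removing the common factor \<open>m\<close>; the smaller one is used up. So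
    \<open>A dvd B * y\<close> yields \<open>A dvd y\<close> in either case, and the annihilated
    residues are the multiples of \<open>A\<close>.\<close>
  have AB: "A = 1 \<or> B = 1" unfolding A_def B_def by (auto simp: min_def)
  have "{y \<in> {0..<int (q ^ k)}. (int (p ^ t) * y) mod int (q ^ k) = 0} = (\<lambda>i. A * i) ` {0..<m}" (is "?L = ?R")
  proof (intro equalityI subsetI)
    fix y assume y: "y \<in> ?L"
    then have "m * A dvd m * (B * y)" unfolding qk pt by (simp add: mod_eq_0_iff_dvd mult.assoc)
    then have "A dvd y" using AB pos by auto
    then obtain i where i: "y = A * i" by blast
    have "0 \<le> A * i" "A * i < A * m" using y i unfolding qk by (auto simp: mult.commute)
    then have "0 \<le> i" "i < m" using pos by (auto simp: zero_le_mult_iff)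
    then show "y \<in> ?R" using i by auto
  next
    fix y assume "y \<in> ?R"
    then obtain i where y: "y = A * i" and "i \<in> {0..<m}" by blast
    then have i: "y = A * i" "0 \<le> i" "i < m" by auto
    have "m * B * y = (m * A) * (B * i)" using i by simp
    moreover have "A * i < m * A" using i pos by (simp add: mult.commute)
    ultimately show "y \<in> ?L" using i pos unfolding qk pt by simp
  qed
  moreover have "inj_on (\<lambda>i. A * i) {0..<m}" using pos by (auto intro: inj_onI)
  moreover have "nat m = p ^ min k t" unfolding m_def by (rule nat_int)
  ultimately show ?thesis using True by (simp add: card_image)
next
  case False
  have "{y \<in> {0..<int (q ^ k)}. (int (p ^ t) * y) mod int (q ^ k) = 0} = {0}"
  proof -
    have c: "coprime (int (q ^ k)) (int (p ^ t))" using False assms by (simp add: primes_coprime)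
    have "y = 0" if "0 \<le> y" "y < int (q ^ k)" "int (q ^ k) dvd int (p ^ t) * y" for y
      using that c by (metis coprime_dvd_mult_right_iff zdvd_not_zless order_le_less)
    moreover have "int (q ^ k) > 0" using assms by (simp add: prime_gt_0_nat)
    ultimately show ?thesis by (auto simp: mod_eq_0_iff_dvd simp del: of_nat_power)
  qed
  then show ?thesis using False by simp
qed

text \<open>Being killed by \<open>p ^ t\<close> is tested coordinate by coordinate, so the count is
  a product over \<open>J\<close>, to which coordinates at other primes contribute 1.\<close>

lemma card_torsion_primary_product:
  assumes "finite J" "\<And>j. j \<in> J \<Longrightarrow> prime (\<pi> j)" "prime p"
  shows "card {x \<in> carrier (primary_product J \<pi> \<kappa>). x [^]\<^bsub>primary_product J \<pi> \<kappa>\<^esub> (p ^ t) = \<one>\<^bsub>primary_product J \<pi> \<kappa>\<^esub>}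
     = p ^ (\<Sum>j\<in>{j \<in> J. \<pi> j = p}. min (\<kappa> j) t)"
proof -
  have "{x \<in> carrier (primary_product J \<pi> \<kappa>). x [^]\<^bsub>primary_product J \<pi> \<kappa>\<^esub> (p ^ t) = \<one>\<^bsub>primary_product J \<pi> \<kappa>\<^esub>}
      = (\<Pi>\<^sub>E j\<in>J. {y \<in> {0..<int (\<pi> j ^ \<kappa> j)}. (int (p ^ t) * y) mod int (\<pi> j ^ \<kappa> j) = 0})"
    using assms(2) by (auto simp: carrier_primary_product pow_primary_product one_primary_product PiE_iff fun_eq_iff restrict_def extensional_def)
  then have "card {x \<in> carrier (primary_product J \<pi> \<kappa>). x [^]\<^bsub>primary_product J \<pi> \<kappa>\<^esub> (p ^ t) = \<one>\<^bsub>primary_product J \<pi> \<kappa>\<^esub>}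
      = (\<Prod>j\<in>J. card {y \<in> {0..<int (\<pi> j ^ \<kappa> j)}. (int (p ^ t) * y) mod int (\<pi> j ^ \<kappa> j) = 0})"
    using assms(1) by (simp only: card_PiE)
  also have "\<dots> = (\<Prod>j\<in>J. if \<pi> j = p then p ^ min (\<kappa> j) t else 1)"
    using assms by (intro prod.cong refl card_annihilated_residues) auto
  also have "\<dots> = p ^ (\<Sum>j\<in>{j \<in> J. \<pi> j = p}. min (\<kappa> j) t)"
    using assms(1) by (simp add: prod.If_cases power_sum Int_def)
  finally show ?thesis .
qed

text \<open>The torsion counts and the exponent bounds depend only on which powers of which elements
  are trivial; this is all that they take from an isomorphism.\<close>

lemma iso_torsion_bij:
  fixes G (structure) and H (structure)
  assumes "group G" "group H" "G \<cong> H"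
  obtains f where "bij_betw f (carrier G) (carrier H)"
    "\<And>x n::nat. x \<in> carrier G \<Longrightarrow> f x [^]\<^bsub>H\<^esub> n = \<one>\<^bsub>H\<^esub> \<longleftrightarrow> x [^]\<^bsub>G\<^esub> n = \<one>\<^bsub>G\<^esub>"
proof -
  obtain f where f: "f \<in> iso G H" using assms(3) unfolding is_iso_def by blast
  then have hom: "f \<in> hom G H" and bij: "bij_betw f (carrier G) (carrier H)" unfolding iso_def by auto
  have "f x [^]\<^bsub>H\<^esub> n = \<one>\<^bsub>H\<^esub> \<longleftrightarrow> x [^]\<^bsub>G\<^esub> n = \<one>\<^bsub>G\<^esub>" if "x \<in> carrier G" for x and n :: nat
  proof -
    interpret group_hom G H f using assms hom by (simp add: group_hom_def group_hom_axioms_def)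
    have "f x [^]\<^bsub>H\<^esub> n = f (x [^]\<^bsub>G\<^esub> n)" using that by (simp add: hom_nat_pow)
    then show ?thesis using that bij
      by (metis G.nat_pow_closed G.one_closed bij_betw_imp_inj_on hom_one inj_on_contraD)
  qed
  then show ?thesis using that bij by blast
qed

lemma iso_card_torsion:
  assumes "group G" "group H" "G \<cong> H"
  shows "card {x \<in> carrier G. x [^]\<^bsub>G\<^esub> (n::nat) = \<one>\<^bsub>G\<^esub>} = card {x \<in> carrier H. x [^]\<^bsub>H\<^esub> n = \<one>\<^bsub>H\<^esub>}"
proof -
  obtain f where f: "bij_betw f (carrier G) (carrier H)"
    "\<And>x n::nat. x \<in> carrier G \<Longrightarrow> f x [^]\<^bsub>H\<^esub> n = \<one>\<^bsub>H\<^esub> \<longleftrightarrow> x [^]\<^bsub>G\<^esub> n = \<one>\<^bsub>G\<^esub>"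
    using iso_torsion_bij assms by blast
  then have "bij_betw f {x \<in> carrier G. x [^]\<^bsub>G\<^esub> n = \<one>\<^bsub>G\<^esub>} {x \<in> carrier H. x [^]\<^bsub>H\<^esub> n = \<one>\<^bsub>H\<^esub>}"
    unfolding bij_betw_def inj_on_def by (auto simp: image_iff) (metis imageE)
  then show ?thesis by (rule bij_betw_same_card)
qed

text \<open>
  The multiplicity of \<open>t\<close> is the second difference of the exponents
  \<open>\<Sum>a. min (f a) t\<close> of the torsion counts.
\<close>

lemma card_eq_from_min_sums:
  fixes f :: "'a \<Rightarrow> nat"
  assumes "finite A" "t \<ge> 1"
  shows "int (card {a \<in> A. f a = t})
    = 2 * int (\<Sum>a\<in>A. min (f a) t) - int (\<Sum>a\<in>A. min (f a) (t - 1)) - int (\<Sum>a\<in>A. min (f a) (t + 1))"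
proof -
  have "int (card {a \<in> A. f a = t}) = (\<Sum>a\<in>A. if f a = t then 1 else 0)"
    using assms(1) by (simp add: sum.If_cases Int_def)
  \<comment> \<open>As a function of \<open>t\<close>, \<open>min c t\<close> has slope 1 up to
    \<open>c\<close> and slope 0 afterwards, so its negated second difference indicates
    \<open>t = c\<close>. The hypothesis on \<open>t\<close> keeps the truncated
    \<open>t - 1\<close> a true predecessor.\<close>
  also have "\<dots> = (\<Sum>a\<in>A. 2 * int (min (f a) t) - int (min (f a) (t - 1)) - int (min (f a) (t + 1)))"
    using assms(2) by (intro sum.cong) (auto simp: min_def)
  finally show ?thesis by (simp add: sum_subtractf sum_distrib_left)
qed

text \<open>Equal torsion counts are equal powers of \<open>p > 1\<close>, so the sums of minima
  agree for every \<open>u\<close>; second differences then give the multiplicities.\<close>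

lemma iso_primary_product_multiplicities:
  assumes J: "finite J" "\<And>j. j \<in> J \<Longrightarrow> prime (\<pi> j)"
    and J': "finite J'" "\<And>j. j \<in> J' \<Longrightarrow> prime (\<pi>' j)"
    and iso: "primary_product J \<pi> \<kappa> \<cong> primary_product J' \<pi>' \<kappa>'"
    and p: "prime p" and t: "t \<ge> 1"
  shows "card {j \<in> J. \<pi> j = p \<and> \<kappa> j = t} = card {j \<in> J'. \<pi>' j = p \<and> \<kappa>' j = t}"
proof -
  have p1: "p > 1" using p prime_gt_1_nat by blast
  have eq: "(\<Sum>j\<in>{j \<in> J. \<pi> j = p}. min (\<kappa> j) u) = (\<Sum>j\<in>{j \<in> J'. \<pi>' j = p}. min (\<kappa>' j) u)" for u
    using iso_card_torsion[OF _ _ iso, of "p ^ u"] comm_group_primary_product p1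
    by (simp add: card_torsion_primary_product[OF J p] card_torsion_primary_product[OF J' p] comm_group.axioms(2)[OF comm_group_primary_product])
  have "int (card {j \<in> {j \<in> J. \<pi> j = p}. \<kappa> j = t}) = int (card {j \<in> {j \<in> J'. \<pi>' j = p}. \<kappa>' j = t})"
    using J(1) J'(1) t by (subst (1 2) card_eq_from_min_sums) (simp_all add: eq)
  then show ?thesis by simp
qed

section \<open>Multiplicities determine the product\<close>

lemma iso_primary_product_reindex:
  assumes f: "bij_betw f J J'" and eq: "\<And>j. j \<in> J \<Longrightarrow> \<pi> j ^ \<kappa> j = \<pi>' (f j) ^ \<kappa>' (f j)"
  shows "primary_product J \<pi> \<kappa> \<cong> primary_product J' \<pi>' \<kappa>'"
proof -
  define g where "g = the_inv_into J f"
  have fJ: "\<And>j. j \<in> J \<Longrightarrow> f j \<in> J'" using f bij_betwE by blast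
  have gJ: "\<And>i. i \<in> J' \<Longrightarrow> g i \<in> J \<and> f (g i) = i" unfolding g_def
    using f by (metis bij_betw_def f_the_inv_into_f the_inv_into_into order_refl)
  have gf: "\<And>j. j \<in> J \<Longrightarrow> g (f j) = j" unfolding g_def
    using f by (metis bij_betw_def the_inv_into_f_f)
  define h where "h = (\<lambda>x. \<lambda>i\<in>J'. x (g i) :: int)"
  define h' where "h' = (\<lambda>x. \<lambda>j\<in>J. x (f j) :: int)"
  have eq': "\<pi>' i ^ \<kappa>' i = \<pi> (g i) ^ \<kappa> (g i)" if "i \<in> J'" for i using eq gJ[OF that] by simp
  have "group_isomorphisms (primary_product J \<pi> \<kappa>) (primary_product J' \<pi>' \<kappa>') h h'"
    unfolding group_isomorphisms_def
  proof (intro conjI)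
    show "h \<in> hom (primary_product J \<pi> \<kappa>) (primary_product J' \<pi>' \<kappa>')"
      unfolding primary_product_def h_def
      by (rule homI) (auto simp: gJ eq' PiE_iff simp del: of_nat_power)
    show "h' \<in> hom (primary_product J' \<pi>' \<kappa>') (primary_product J \<pi> \<kappa>)"
      unfolding primary_product_def h'_def
      by (rule homI) (auto simp: fJ eq PiE_iff simp del: of_nat_power)
    show "\<forall>x\<in>carrier (primary_product J \<pi> \<kappa>). h' (h x) = x"
      by (auto simp: h_def h'_def primary_product_def fJ gf PiE_iff extensional_def)
    show "\<forall>y\<in>carrier (primary_product J' \<pi>' \<kappa>'). h (h' y) = y"
      by (auto simp: h_def h'_def primary_product_def gJ PiE_iff extensional_def fun_eq_iff)
  qed
  then show ?thesis by (metis group_isomorphisms_imp_iso is_isoI)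
qed

text \<open>The index sets split into fibres over the pairs of a prime and an exponent. Fibres of
  equal size are in bijection, and these bijections glue to a reindexing that preserves every
  modulus.\<close>

lemma iso_primary_product_of_multiplicities:
  assumes J: "finite J" "\<And>j. j \<in> J \<Longrightarrow> prime (\<pi> j) \<and> \<kappa> j \<ge> 1"
    and J': "finite J'" "\<And>j. j \<in> J' \<Longrightarrow> prime (\<pi>' j) \<and> \<kappa>' j \<ge> 1"
    and eq: "\<And>p t. prime p \<Longrightarrow> t \<ge> 1 \<Longrightarrow> card {j \<in> J. \<pi> j = p \<and> \<kappa> j = t} = card {j \<in> J'. \<pi>' j = p \<and> \<kappa>' j = t}"
  shows "primary_product J \<pi> \<kappa> \<cong> primary_product J' \<pi>' \<kappa>'"
proof -
  let ?A = "\<lambda>(p, t). {j \<in> J. \<pi> j = p \<and> \<kappa> j = t}" and ?B = "\<lambda>(p, t). {j \<in> J'. \<pi>' j = p \<and> \<kappa>' j = t}"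
  have "\<exists>f. bij_betw f (?A a) (?B a)" for a
  proof (cases a)
    case (Pair p t)
    have "card (?A a) = card (?B a)"
    proof (cases "prime p \<and> t \<ge> 1")
      case True then show ?thesis using eq Pair by simp
    next
      case False
      then have "?A a = {}" "?B a = {}" using J(2) J'(2) Pair by auto
      then show ?thesis by simp
    qed
    moreover have "finite (?A a)" "finite (?B a)" using J(1) J'(1) Pair by auto
    ultimately show ?thesis using finite_same_card_bij by blast
  qed
  then have "\<forall>a. \<exists>f. bij_betw f (?A a) (?B a)" by blast
  then obtain F where "\<forall>a. bij_betw (F a) (?A a) (?B a)" by (rule choice[THEN exE])
  then have F: "bij_betw (F a) (?A a) (?B a)" for a by (rule spec)
  define f where "f j = F (\<pi> j, \<kappa> j) j" for j
  have fJ: "f j \<in> J' \<and> \<pi>' (f j) = \<pi> j \<and> \<kappa>' (f j) = \<kappa> j" if "j \<in> J" for j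
    using bij_betwE[OF F[of "(\<pi> j, \<kappa> j)"]] that unfolding f_def by auto
  have "inj_on f J"
  proof (rule inj_onI)
    fix x y assume xy: "x \<in> J" "y \<in> J" "f x = f y"
    then have "\<pi> x = \<pi> y" "\<kappa> x = \<kappa> y" using fJ by metis+
    then show "x = y" using xy bij_betw_imp_inj_on[OF F[of "(\<pi> x, \<kappa> x)"]]
      unfolding f_def inj_on_def by auto
  qed
  moreover have "f ` J = J'"
  proof (intro equalityI subsetI)
    fix i assume i: "i \<in> J'"
    then have "i \<in> F (\<pi>' i, \<kappa>' i) ` ?A (\<pi>' i, \<kappa>' i)"
      using bij_betw_imp_surj_on[OF F[of "(\<pi>' i, \<kappa>' i)"]] by auto
    then show "i \<in> f ` J" unfolding f_def by force
  qed (use fJ in auto)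
  ultimately have "bij_betw f J J'" unfolding bij_betw_def by blast
  then show ?thesis by (rule iso_primary_product_reindex) (use fJ in auto)
qed

section \<open>Existence of a decomposition into cyclic primary groups\<close>

lemma (in comm_group) iso_cyclic_times_complement:
  assumes a: "a \<in> carrier G" and K: "subgroup K G" and q: "q > 0" "ord a = q"
    and ex: "\<And>x. x \<in> carrier G \<Longrightarrow> \<exists>k\<in>K. \<exists>i::int. x = k \<otimes> a [^] i"
    and tr: "\<And>i::int. a [^] i \<in> K \<Longrightarrow> int q dvd i"
  shows "integer_mod_group q \<times>\<times> (G\<lparr>carrier := K\<rparr>) \<cong> G"
proof -
  \<comment> \<open>Compatible with reduction modulo \<open>q\<close> because
    \<open>ord a = q\<close>; injective by the trivial intersection \<open>tr\<close>, onto by the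
    spanning property \<open>ex\<close>.\<close>
  define h where "h = (\<lambda>(i::int, k). k \<otimes> a [^] i)"
  have Kc: "\<And>k. k \<in> K \<Longrightarrow> k \<in> carrier G" using K subgroup.mem_carrier by fastforce
  have mod: "a [^] (i mod int q) = a [^] i" for i :: int
    using int_pow_eq[OF a, of i "i mod int q"] q by (simp add: mod_eq_dvd_iff [symmetric] dvd_minus_mod dvd_diff_commute)
  have "h \<in> iso (integer_mod_group q \<times>\<times> (G\<lparr>carrier := K\<rparr>)) G"
  proof (rule isoI)
    show "h \<in> hom (integer_mod_group q \<times>\<times> (G\<lparr>carrier := K\<rparr>)) G"
      by (rule homI) (auto simp: h_def Kc a mod int_pow_mult m_ac)
    show "bij_betw h (carrier (integer_mod_group q \<times>\<times> (G\<lparr>carrier := K\<rparr>))) (carrier G)"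
      unfolding bij_betw_def
    proof (intro conjI equalityI subsetI inj_onI)
      fix u v assume u: "u \<in> carrier (integer_mod_group q \<times>\<times> (G\<lparr>carrier := K\<rparr>))"
        and v: "v \<in> carrier (integer_mod_group q \<times>\<times> (G\<lparr>carrier := K\<rparr>))" and eq: "h u = h v"
      obtain i k where i: "u = (i, k)" "0 \<le> i" "i < int q" "k \<in> K" using u q by (auto simp: carrier_integer_mod_group)
      obtain j l where j: "v = (j, l)" "0 \<le> j" "j < int q" "l \<in> K" using v q by (auto simp: carrier_integer_mod_group)
      have c: "k \<in> carrier G" "l \<in> carrier G" using i j Kc by auto
      have e: "k \<otimes> a [^] i = l \<otimes> a [^] j" using eq i j by (simp add: h_def)
      have "a [^] (i - j) = inv k \<otimes> (k \<otimes> a [^] i) \<otimes> inv (a [^] j)"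
        using a c by (simp add: int_pow_diff flip: m_assoc)
      also have "\<dots> = inv k \<otimes> l" unfolding e using a c by (simp add: m_assoc)
      finally have e2: "a [^] (i - j) = inv k \<otimes> l" .
      then have "a [^] (i - j) \<in> K" using K i j subgroup.m_closed subgroup.m_inv_closed by metis
      then have "int q dvd i - j" by (rule tr)
      then have ij: "i = j" using i j by (metis mod_eq_dvd_iff mod_pos_pos_trivial)
      then have "k = l" using e a c by simp
      then show "u = v" using ij i j by simp
    next
      fix x assume "x \<in> h ` carrier (integer_mod_group q \<times>\<times> (G\<lparr>carrier := K\<rparr>))"
      then show "x \<in> carrier G" by (auto simp: h_def Kc a)
    next
      fix x assume "x \<in> carrier G"
      then obtain k i where "k \<in> K" "x = k \<otimes> a [^] (i::int)" using ex by blast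
      then have "x = h (i mod int q, k)" "(i mod int q, k) \<in> carrier (integer_mod_group q \<times>\<times> (G\<lparr>carrier := K\<rparr>))"
        using q by (auto simp: h_def mod carrier_integer_mod_group)
      then show "x \<in> h ` carrier (integer_mod_group q \<times>\<times> (G\<lparr>carrier := K\<rparr>))" by blast
    qed
  qed
  then show ?thesis by (rule is_isoI)
qed

lemma (in comm_group) comm_group_subgroup:
  assumes "subgroup K G"
  shows "comm_group (G\<lparr>carrier := K\<rparr>)"
  using assms subgroup.mem_carrier[OF assms]
  by (intro group.group_comm_groupI subgroup_imp_group) (auto simp: m_comm)

lemma iso_primary_product_Suc:
  "integer_mod_group (\<pi> n ^ \<kappa> n) \<times>\<times> primary_product {..<n::nat} \<pi> \<kappa> \<cong> primary_product {..<Suc n} \<pi> \<kappa>"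
proof -
  define h where "h = (\<lambda>(i::int, x). x(n := i) :: nat \<Rightarrow> int)"
  define h' where "h' = (\<lambda>x::nat \<Rightarrow> int. (x n, restrict x {..<n}))"
  have "group_isomorphisms (integer_mod_group (\<pi> n ^ \<kappa> n) \<times>\<times> primary_product {..<n} \<pi> \<kappa>) (primary_product {..<Suc n} \<pi> \<kappa>) h h'"
    unfolding group_isomorphisms_def
  proof (intro conjI)
    show "h \<in> hom (integer_mod_group (\<pi> n ^ \<kappa> n) \<times>\<times> primary_product {..<n} \<pi> \<kappa>) (primary_product {..<Suc n} \<pi> \<kappa>)"
      (is "h \<in> hom ?A ?B")
    proof (rule homI)
      fix u assume "u \<in> carrier ?A"
      then obtain i x where u: "u = (i, x)" "i \<in> carrier (integer_mod_group (\<pi> n ^ \<kappa> n))"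
          "x \<in> carrier (primary_product {..<n} \<pi> \<kappa>)" by auto
      have "{..<Suc n} = insert n {..<n}" by auto
      then show "h u \<in> carrier ?B" using u fun_upd_in_PiE[of n "{..<n}"]
        by (auto simp: h_def primary_product_def intro!: PiE_fun_upd)
    next
      fix u v :: "int \<times> (nat \<Rightarrow> int)"
      obtain i x j y where "u = (i, x)" "v = (j, y)" by (cases u, cases v)
      then show "h (u \<otimes>\<^bsub>?A\<^esub> v) = h u \<otimes>\<^bsub>?B\<^esub> h v"
        by (intro ext) (simp add: h_def primary_product_def)
    qed
    show "h' \<in> hom (primary_product {..<Suc n} \<pi> \<kappa>) (integer_mod_group (\<pi> n ^ \<kappa> n) \<times>\<times> primary_product {..<n} \<pi> \<kappa>)"
      unfolding primary_product_def h'_def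
      by (rule homI) (auto simp: PiE_iff extensional_def less_Suc_eq fun_eq_iff)
    show "\<forall>x\<in>carrier (integer_mod_group (\<pi> n ^ \<kappa> n) \<times>\<times> primary_product {..<n} \<pi> \<kappa>). h' (h x) = x"
      by (auto simp: h_def h'_def primary_product_def PiE_iff extensional_def fun_eq_iff)
    show "\<forall>y\<in>carrier (primary_product {..<Suc n} \<pi> \<kappa>). h (h' y) = y"
      by (auto simp: h_def h'_def primary_product_def PiE_iff extensional_def fun_eq_iff)
  qed
  then show ?thesis by (metis group_isomorphisms_imp_iso is_isoI)
qed

lemma primary_product_cong:
  assumes "\<And>j. j \<in> J \<Longrightarrow> \<pi> j ^ \<kappa> j = \<pi>' j ^ \<kappa>' j"
  shows "primary_product J \<pi> \<kappa> = primary_product J \<pi>' \<kappa>'"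
  unfolding primary_product_def product_group_def using assms
  by (auto simp: fun_eq_iff restrict_def intro!: PiE_cong simp del: of_nat_power)

text \<open>Induction on the order: the complement \<open>K\<close> of a cyclic primary subgroup is
  proper, since \<open>a\<close> in \<open>K\<close> would force \<open>p ^ e\<close> to divide
  1.\<close>

theorem finite_comm_group_iso_primary_product:
  fixes G :: "('a, 'b) monoid_scheme"
  assumes "comm_group G" "finite (carrier G)"
  shows "\<exists>n \<pi> \<kappa>. (\<forall>j<n. prime (\<pi> j) \<and> \<kappa> j \<ge> 1) \<and> G \<cong> primary_product {..<n::nat} \<pi> \<kappa>"
  using assms
proof (induction "card (carrier G)" arbitrary: G rule: less_induct)
  case less
  interpret G: comm_group G by fact
  show ?case
  proof (cases "carrier G = {\<one>\<^bsub>G\<^esub>}")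
    case True
    \<comment> \<open>The trivial group is the empty product; over no index the constants 2 and 1
      are arbitrary.\<close>
    define h where "h = (\<lambda>x::'a. \<lambda>j\<in>{..<0::nat}. 0::int)"
    have "h \<in> iso G (primary_product {..<0} (\<lambda>_. 2) (\<lambda>_. 1))"
      by (auto simp: iso_def hom_def bij_betw_def h_def primary_product_def True)
    then have "G \<cong> primary_product {..<0::nat} (\<lambda>_. 2) (\<lambda>_. 1)" by (rule is_isoI)
    then show ?thesis by blast
  next
    case False
    then obtain a K p e where a: "a \<in> carrier G" "subgroup K G" "prime p" "e \<ge> (1::nat)" "G.ord a = p ^ e"
      and ex: "\<And>x. x \<in> carrier G \<Longrightarrow> \<exists>k\<in>K. \<exists>i::int. x = k \<otimes>\<^bsub>G\<^esub> a [^]\<^bsub>G\<^esub> i"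
      and tr: "\<And>i::int. a [^]\<^bsub>G\<^esub> i \<in> K \<Longrightarrow> int (p ^ e) dvd i"
      using G.cyclic_primary_complement[OF less.prems(2)] by metis
    have pe: "p ^ e > 1" using a(3,4) by (metis one_less_power prime_gt_1_nat zero_less_one less_le_trans)
    define GK where "GK = G\<lparr>carrier := K\<rparr>"
    interpret K: comm_group GK unfolding GK_def by (rule G.comm_group_subgroup[OF a(2)])
    have "a \<notin> K"
    proof
      assume "a \<in> K"
      then have "a [^]\<^bsub>G\<^esub> (1::int) \<in> K" using a by simp
      then have "int (p ^ e) dvd 1" using tr by blast
      then show False using pe by (metis int_dvd_int_iff nat_dvd_1_iff_1 of_nat_1 less_irrefl)
    qed
    then have "K \<subset> carrier G" using a subgroup.subset[OF a(2)] by blast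
    then have "card (carrier GK) < card (carrier G)" "finite (carrier GK)"
      using less.prems(2) by (auto simp: GK_def psubset_card_mono finite_subset)
    then obtain n \<pi> \<kappa> where IH: "\<forall>j<n. prime (\<pi> j) \<and> \<kappa> j \<ge> 1" "GK \<cong> primary_product {..<n::nat} \<pi> \<kappa>"
      using less.hyps[of GK] K.comm_group_axioms by blast
    define \<pi>' \<kappa>' where "\<pi>' = \<pi>(n := p)" and "\<kappa>' = \<kappa>(n := e)"
    have eq: "primary_product {..<n} \<pi> \<kappa> = primary_product {..<n} \<pi>' \<kappa>'"
      by (rule primary_product_cong) (simp add: \<pi>'_def \<kappa>'_def)
    have "integer_mod_group (p ^ e) \<times>\<times> GK \<cong> G" unfolding GK_def
      by (rule G.iso_cyclic_times_complement[OF a(1,2) _ a(5) ex tr]) (use pe in linarith)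
    then have "G \<cong> integer_mod_group (p ^ e) \<times>\<times> GK"
      using group.iso_sym[OF DirProd_group[OF group_integer_mod_group K.is_group]] by blast
    also have "integer_mod_group (p ^ e) \<times>\<times> GK \<cong> integer_mod_group (\<pi>' n ^ \<kappa>' n) \<times>\<times> primary_product {..<n} \<pi>' \<kappa>'"
      using group.DirProd_iso_trans[OF group_integer_mod_group iso_refl IH(2)[unfolded eq]] unfolding \<pi>'_def \<kappa>'_def by simp
    also have "\<dots> \<cong> primary_product {..<Suc n} \<pi>' \<kappa>'" by (rule iso_primary_product_Suc)
    finally have "G \<cong> primary_product {..<Suc n} \<pi>' \<kappa>'" .
    moreover have "\<forall>j<Suc n. prime (\<pi>' j) \<and> \<kappa>' j \<ge> 1" using IH(1) a by (auto simp: \<pi>'_def \<kappa>'_def less_Suc_eq)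
    ultimately show ?thesis by blast
  qed
qed

section \<open>Types of primary components\<close>

text \<open>For each prime \<open>p\<close> the \<open>p\<close>-primary part is killed by
  \<open>p ^ r\<close>. Phrased without a type or a decomposition, the bound passes at once through
  isomorphisms and direct products.\<close>

definition primary_exponents_le :: "nat \<Rightarrow> ('a, 'b) monoid_scheme \<Rightarrow> bool" where
  "primary_exponents_le r G \<longleftrightarrow>
     (\<forall>p x k. prime p \<longrightarrow> x \<in> carrier G \<longrightarrow> x [^]\<^bsub>G\<^esub> (p ^ k :: nat) = \<one>\<^bsub>G\<^esub> \<longrightarrow> x [^]\<^bsub>G\<^esub> (p ^ r) = \<one>\<^bsub>G\<^esub>)"

text \<open>The arbitrary predicate \<open>P\<close> on the set of annihilating exponents covers
  both uses: the bound \<open>primary_exponents_le\<close> and the property of being a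
  \<open>p\<close>-group.\<close>

lemma iso_ball_torsion:
  fixes G (structure) and H (structure)
  assumes "group G" "group H" "G \<cong> H"
  shows "(\<forall>x\<in>carrier G. P (\<lambda>n::nat. x [^]\<^bsub>G\<^esub> n = \<one>\<^bsub>G\<^esub>)) \<longleftrightarrow> (\<forall>x\<in>carrier H. P (\<lambda>n::nat. x [^]\<^bsub>H\<^esub> n = \<one>\<^bsub>H\<^esub>))"
proof -
  obtain f where f: "bij_betw f (carrier G) (carrier H)"
    "\<And>x n::nat. x \<in> carrier G \<Longrightarrow> f x [^]\<^bsub>H\<^esub> n = \<one>\<^bsub>H\<^esub> \<longleftrightarrow> x [^]\<^bsub>G\<^esub> n = \<one>\<^bsub>G\<^esub>"
    using iso_torsion_bij assms by blast
  have "carrier H = f ` carrier G" using f(1) bij_betw_imp_surj_on by blast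
  then show ?thesis using f(2) by simp
qed

lemma iso_primary_exponents_le:
  assumes "group G" "group H" "G \<cong> H"
  shows "primary_exponents_le r G \<longleftrightarrow> primary_exponents_le r H"
  using iso_ball_torsion[OF assms, of "\<lambda>t. \<forall>p k. prime p \<longrightarrow> t (p ^ k) \<longrightarrow> t (p ^ r)"]
  unfolding primary_exponents_le_def by blast

lemma pow_DirProd:
  "(x, y) [^]\<^bsub>G \<times>\<times> H\<^esub> (n::nat) = (x [^]\<^bsub>G\<^esub> n, y [^]\<^bsub>H\<^esub> n)"
  by (induction n) (auto simp: nat_pow_def)

text \<open>Powers are taken in each coordinate, and pairs with one trivial entry recover the
  factors. Hence bounding a group is the same as bounding both members of a decomposition.\<close>

lemma primary_exponents_le_DirProd:
  assumes "group G" "group H"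
  shows "primary_exponents_le r (G \<times>\<times> H) \<longleftrightarrow> primary_exponents_le r G \<and> primary_exponents_le r H"
proof -
  interpret G: group G by fact
  interpret H: group H by fact
  show ?thesis
  proof (intro iffI conjI)
    assume L: "primary_exponents_le r (G \<times>\<times> H)"
    show "primary_exponents_le r G" unfolding primary_exponents_le_def
    proof (intro allI impI)
      fix p k :: nat and x assume "prime p" "x \<in> carrier G" "x [^]\<^bsub>G\<^esub> (p ^ k) = \<one>\<^bsub>G\<^esub>"
      then have "(x, \<one>\<^bsub>H\<^esub>) [^]\<^bsub>G \<times>\<times> H\<^esub> (p ^ r) = \<one>\<^bsub>G \<times>\<times> H\<^esub>"
        using L[unfolded primary_exponents_le_def, rule_format, of p "(x, \<one>\<^bsub>H\<^esub>)" k] by (simp add: pow_DirProd)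
      then show "x [^]\<^bsub>G\<^esub> (p ^ r) = \<one>\<^bsub>G\<^esub>" by (simp add: pow_DirProd)
    qed
    show "primary_exponents_le r H" unfolding primary_exponents_le_def
    proof (intro allI impI)
      fix p k :: nat and x assume "prime p" "x \<in> carrier H" "x [^]\<^bsub>H\<^esub> (p ^ k) = \<one>\<^bsub>H\<^esub>"
      then have "(\<one>\<^bsub>G\<^esub>, x) [^]\<^bsub>G \<times>\<times> H\<^esub> (p ^ r) = \<one>\<^bsub>G \<times>\<times> H\<^esub>"
        using L[unfolded primary_exponents_le_def, rule_format, of p "(\<one>\<^bsub>G\<^esub>, x)" k] by (simp add: pow_DirProd)
      then show "x [^]\<^bsub>H\<^esub> (p ^ r) = \<one>\<^bsub>H\<^esub>" by (simp add: pow_DirProd)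
    qed
  next
    assume "primary_exponents_le r G \<and> primary_exponents_le r H"
    then show "primary_exponents_le r (G \<times>\<times> H)"
      unfolding primary_exponents_le_def by (clarsimp simp: pow_DirProd) blast
  qed
qed

definition unit_vector :: "'i set \<Rightarrow> 'i \<Rightarrow> 'i \<Rightarrow> int" where
  "unit_vector J i = (\<lambda>j\<in>J. if j = i then 1 else 0)"

text \<open>Exponents of at least 1 make every modulus exceed 1, so that the entry 1 is a
  residue.\<close>

lemma unit_vector_in_primary_product:
  assumes "\<And>j. j \<in> J \<Longrightarrow> prime (\<pi> j) \<and> \<kappa> j \<ge> 1"
  shows "unit_vector J i \<in> carrier (primary_product J \<pi> \<kappa>)"
proof -
  have "int (\<pi> j ^ \<kappa> j) > 1" if "j \<in> J" for j
    using assms[OF that] by (metis one_less_power prime_gt_1_nat zero_less_one less_le_trans of_nat_1 of_nat_less_iff)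
  then show ?thesis unfolding unit_vector_def using assms
    by (subst carrier_primary_product) (auto simp: prime_gt_0_nat)
qed

lemma unit_vector_pow_eq_one:
  assumes i: "i \<in> J" and "prime (\<pi> i)"
    and "unit_vector J i [^]\<^bsub>primary_product J \<pi> \<kappa>\<^esub> (n::nat) = \<one>\<^bsub>primary_product J \<pi> \<kappa>\<^esub>"
  shows "\<pi> i ^ \<kappa> i dvd n"
proof -
  have "(unit_vector J i [^]\<^bsub>primary_product J \<pi> \<kappa>\<^esub> n) i = 0" using assms by (simp add: one_primary_product)
  then have "int n mod int (\<pi> i ^ \<kappa> i) = 0" using i by (simp add: pow_primary_product unit_vector_def)
  then show ?thesis by (metis mod_eq_0_iff_dvd int_dvd_int_iff)
qed

text \<open>Necessity is tested on unit vectors, whose orders are multiples of the moduli.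
  Conversely, a \<open>p\<close>-primary element has zero entries at the other primes, and
  \<open>p ^ r\<close> kills its entries at \<open>p\<close>.\<close>

lemma primary_exponents_le_primary_product:
  assumes J: "\<And>j. j \<in> J \<Longrightarrow> prime (\<pi> j) \<and> \<kappa> j \<ge> 1"
  shows "primary_exponents_le r (primary_product J \<pi> \<kappa>) \<longleftrightarrow> (\<forall>j\<in>J. \<kappa> j \<le> r)"
proof
  assume L: "primary_exponents_le r (primary_product J \<pi> \<kappa>)"
  show "\<forall>j\<in>J. \<kappa> j \<le> r"
  proof
    fix i assume i: "i \<in> J"
    then have pr: "prime (\<pi> i)" using J by blast
    obtain k where "unit_vector J i [^]\<^bsub>primary_product J \<pi> \<kappa>\<^esub> (\<pi> i ^ k) = \<one>\<^bsub>primary_product J \<pi> \<kappa>\<^esub>"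
      by (rule that[of "\<kappa> i"]) (auto simp: pow_primary_product one_primary_product unit_vector_def)
    then have "unit_vector J i [^]\<^bsub>primary_product J \<pi> \<kappa>\<^esub> (\<pi> i ^ r) = \<one>\<^bsub>primary_product J \<pi> \<kappa>\<^esub>"
      using L pr unit_vector_in_primary_product[of J \<pi> \<kappa> i, OF J] unfolding primary_exponents_le_def by blast
    then have "\<pi> i ^ \<kappa> i dvd \<pi> i ^ r" using unit_vector_pow_eq_one[of i J \<pi> \<kappa>, OF i pr] by blast
    then show "\<kappa> i \<le> r" using pr by (metis power_dvd_imp_le prime_gt_1_nat)
  qed
next
  assume R: "\<forall>j\<in>J. \<kappa> j \<le> r"
  show "primary_exponents_le r (primary_product J \<pi> \<kappa>)" unfolding primary_exponents_le_def
  proof (intro allI impI)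
    fix p k :: nat and x assume p: "prime p" and x: "x \<in> carrier (primary_product J \<pi> \<kappa>)"
      and e: "x [^]\<^bsub>primary_product J \<pi> \<kappa>\<^esub> (p ^ k) = \<one>\<^bsub>primary_product J \<pi> \<kappa>\<^esub>"
    have "int (p ^ r) * x j mod int (\<pi> j ^ \<kappa> j) = 0" if j: "j \<in> J" for j
    proof (cases "\<pi> j = p")
      case True
      have "int (\<pi> j ^ \<kappa> j) dvd int (p ^ r)" using True R j by (simp add: le_imp_power_dvd)
      then show ?thesis by (metis dvd_mult2 mod_eq_0_iff_dvd)
    next
      case False
      have "(x [^]\<^bsub>primary_product J \<pi> \<kappa>\<^esub> (p ^ k)) j = 0" using e j by (simp add: one_primary_product)
      then have "int (\<pi> j ^ \<kappa> j) dvd int (p ^ k) * x j" using j by (simp add: pow_primary_product mod_eq_0_iff_dvd)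
      moreover have "coprime (int (\<pi> j ^ \<kappa> j)) (int (p ^ k))" using False p J[OF j] by (simp add: primes_coprime)
      ultimately have "int (\<pi> j ^ \<kappa> j) dvd x j" using coprime_dvd_mult_right_iff by blast
      then show ?thesis by (metis dvd_mult mod_eq_0_iff_dvd)
    qed
    then show "x [^]\<^bsub>primary_product J \<pi> \<kappa>\<^esub> (p ^ r) = \<one>\<^bsub>primary_product J \<pi> \<kappa>\<^esub>"
      by (auto simp: pow_primary_product one_primary_product intro!: restrict_ext)
  qed
qed

lemma group_of_type_eq_primary_product:
  "group_of_type p as = primary_product {..<length as} (\<lambda>_. p) (\<lambda>i. as ! i)"
  by (simp add: group_of_type_def primary_product_def)

lemma comm_group_group_of_type: "comm_group (group_of_type p as)"
  by (simp add: group_of_type_eq_primary_product comm_group_primary_product)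

lemma card_nth_eq: "card {i. i < length as \<and> as ! i = t} = count (mset as) t"
proof -
  have "card {i. i < length as \<and> as ! i = t} = length (filter (\<lambda>x. x = t) as)"
    by (simp add: length_filter_conv_card)
  also have "\<dots> = count (mset as) t" by (induction as) auto
  finally show ?thesis .
qed

lemma is_partition_nth: "is_partition as \<Longrightarrow> j < length as \<Longrightarrow> Suc 0 \<le> as ! j"
  unfolding is_partition_def by (simp add: Suc_leI)

text \<open>The multiplicities of positive parts agree, 0 is not a part, and a sorted list is
  determined by its multiset. This makes the description in \<open>type_of_p_group\<close>
  unique.\<close>

lemma group_of_type_iso_imp_eq:
  assumes p: "prime p" and as: "is_partition as" and bs: "is_partition bs"
    and iso: "group_of_type p as \<cong> group_of_type p bs"
  shows "as = bs"
proof -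
  have "mset as = mset bs"
  proof (rule multiset_eqI)
    fix t
    show "count (mset as) t = count (mset bs) t"
    proof (cases "t = 0")
      case True
      have "0 \<notin> set as" "0 \<notin> set bs" using as bs unfolding is_partition_def by auto
      then show ?thesis using True by (metis count_mset_0_iff)
    next
      case False
      then show ?thesis
        using iso_primary_product_multiplicities[OF _ _ _ _ iso[unfolded group_of_type_eq_primary_product] p, of t] p
        by (simp add: card_nth_eq)
    qed
  qed
  then show ?thesis using as bs unfolding is_partition_def
    by (metis properties_for_sort)
qed

lemma type_of_p_group_eqI:
  assumes p: "prime p" and G: "group G" and as: "is_partition as" and iso: "G \<cong> group_of_type p as"
  shows "type_of_p_group p G = as"
  unfolding type_of_p_group_def
proof (rule the_equality)
  show "is_partition as \<and> G \<cong> group_of_type p as" using as iso by blast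
  fix bs assume bs: "is_partition bs \<and> G \<cong> group_of_type p bs"
  have "group_of_type p bs \<cong> G" using group.iso_sym[OF G] bs by blast
  then have "group_of_type p bs \<cong> group_of_type p as" using iso iso_trans by blast
  then show "bs = as" using group_of_type_iso_imp_eq p as bs by blast
qed

text \<open>In a decomposition, the unit vector at \<open>i\<close> is killed by a power of
  \<open>p\<close>, which forces \<open>\<pi> i = p\<close>; sorting the exponents gives the
  type.\<close>

lemma finite_p_group_iso_group_of_type:
  assumes p: "prime p" and G: "comm_group G" "finite (carrier G)"
    and pg: "\<And>x. x \<in> carrier G \<Longrightarrow> \<exists>k::nat. x [^]\<^bsub>G\<^esub> (p ^ k) = \<one>\<^bsub>G\<^esub>"
  shows "\<exists>as. is_partition as \<and> G \<cong> group_of_type p as"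
proof -
  have gG: "group G" using G comm_group.axioms(2) by blast
  obtain n \<pi> \<kappa> where d: "\<And>j. j<n \<Longrightarrow> prime (\<pi> j) \<and> \<kappa> j \<ge> 1" and iso: "G \<cong> primary_product {..<n::nat} \<pi> \<kappa>"
    using finite_comm_group_iso_primary_product[OF G] by blast
  have gP: "group (primary_product {..<n::nat} \<pi> \<kappa>)" using comm_group_primary_product comm_group.axioms(2) by blast
  have pg': "\<forall>x\<in>carrier (primary_product {..<n} \<pi> \<kappa>). \<exists>k. x [^]\<^bsub>primary_product {..<n} \<pi> \<kappa>\<^esub> (p ^ k) = \<one>\<^bsub>primary_product {..<n} \<pi> \<kappa>\<^esub>"
    using iso_ball_torsion[OF gG gP iso, of "\<lambda>t. \<exists>k. t (p ^ k)"] pg by blast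
  have \<pi>: "\<pi> i = p" if i: "i < n" for i
  proof -
    have "unit_vector {..<n} i \<in> carrier (primary_product {..<n} \<pi> \<kappa>)"
      using d by (intro unit_vector_in_primary_product) auto
    then obtain k where "unit_vector {..<n} i [^]\<^bsub>primary_product {..<n} \<pi> \<kappa>\<^esub> (p ^ k) = \<one>\<^bsub>primary_product {..<n} \<pi> \<kappa>\<^esub>"
      using pg' by blast
    then have "\<pi> i ^ \<kappa> i dvd p ^ k" using unit_vector_pow_eq_one[of i "{..<n}" \<pi> \<kappa>] d i by auto
    moreover have "\<pi> i dvd \<pi> i ^ \<kappa> i" using d[OF i] by (intro dvd_power) auto
    ultimately have "\<pi> i dvd p ^ k" by (rule dvd_trans[rotated])
    then show ?thesis using p d[OF i] by (meson prime_dvd_power primes_dvd_imp_eq)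
  qed
  define as where "as = sort (map \<kappa> [0..<n])"
  have part: "is_partition as" using d unfolding as_def is_partition_def by fastforce
  have "primary_product {..<n} \<pi> \<kappa> \<cong> group_of_type p as"
    unfolding group_of_type_eq_primary_product
  proof (rule iso_primary_product_of_multiplicities)
    show "prime p \<and> as ! j \<ge> 1" if "j \<in> {..<length as}" for j
      using part p nth_mem[of j as] that unfolding is_partition_def by fastforce
    fix q t :: nat assume "prime q" "t \<ge> 1"
    show "card {j \<in> {..<n}. \<pi> j = q \<and> \<kappa> j = t} = card {j \<in> {..<length as}. p = q \<and> as ! j = t}"
    proof (cases "q = p")
      case True
      have "{j \<in> {..<n}. \<pi> j = q \<and> \<kappa> j = t} = {j. j < length (map \<kappa> [0..<n]) \<and> map \<kappa> [0..<n] ! j = t}"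
      proof (rule Collect_cong)
        fix j show "j \<in> {..<n} \<and> \<pi> j = q \<and> \<kappa> j = t \<longleftrightarrow> j < length (map \<kappa> [0..<n]) \<and> map \<kappa> [0..<n] ! j = t"
          by (cases "j < n") (simp_all add: \<pi> True)
      qed
      then have "card {j \<in> {..<n}. \<pi> j = q \<and> \<kappa> j = t} = count (mset (map \<kappa> [0..<n])) t"
        using card_nth_eq[of "map \<kappa> [0..<n]" t] by argo
      also have "\<dots> = count (mset as) t" unfolding as_def by simp
      also have "\<dots> = card {j \<in> {..<length as}. p = q \<and> as ! j = t}"
        using True card_nth_eq[of as t] by simp
      finally show ?thesis .
    next
      case False
      then have "{j \<in> {..<n}. \<pi> j = q \<and> \<kappa> j = t} = {}" using \<pi> by auto
      then show ?thesis using False by simp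
    qed
  qed (use d in auto)
  then show ?thesis using part iso iso_trans by blast
qed

lemma (in comm_group) subgroup_primary_component:
  fixes p :: nat
  shows "subgroup {x \<in> carrier G. \<exists>k::nat. x [^] (p ^ k) = \<one>} G"
proof (rule subgroupI)
  show "{x \<in> carrier G. \<exists>k::nat. x [^] (p ^ k) = \<one>} \<noteq> {}" using one_closed nat_pow_one by blast
next
  fix x assume "x \<in> {x \<in> carrier G. \<exists>k::nat. x [^] (p ^ k) = \<one>}"
  then obtain k where "x \<in> carrier G" "x [^] (p ^ k) = \<one>" by blast
  moreover from this have "inv x [^] (p ^ k) = \<one>" using nat_pow_inv[of x "p ^ k"] by simp
  ultimately show "inv x \<in> {x \<in> carrier G. \<exists>k::nat. x [^] (p ^ k) = \<one>}" by blast
next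
  fix x y assume "x \<in> {x \<in> carrier G. \<exists>k::nat. x [^] (p ^ k) = \<one>}" "y \<in> {x \<in> carrier G. \<exists>k::nat. x [^] (p ^ k) = \<one>}"
  then obtain k l where x: "x \<in> carrier G" "x [^] (p ^ k) = \<one>" and y: "y \<in> carrier G" "y [^] (p ^ l) = \<one>" by blast
  have "x [^] (p ^ (k + l)) = \<one>" unfolding power_add using x by (metis nat_pow_pow nat_pow_one)
  moreover have "y [^] (p ^ (k + l)) = \<one>" unfolding power_add using y by (metis mult.commute nat_pow_pow nat_pow_one)
  ultimately have "(x \<otimes> y) [^] (p ^ (k + l)) = \<one>" using x(1) y(1) nat_pow_distrib[of x y "p ^ (k + l)"] by simp
  then show "x \<otimes> y \<in> {x \<in> carrier G. \<exists>k::nat. x [^] (p ^ k) = \<one>}" using x y by blast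
qed auto

lemma nat_pow_carrier_update: "x [^]\<^bsub>G\<lparr>carrier := K\<rparr>\<^esub> (n::nat) = x [^]\<^bsub>G\<^esub> n"
  by (simp add: nat_pow_def)

lemma type_of_primary_component:
  assumes p: "prime p" and G: "comm_group G" "finite (carrier G)"
  shows "(\<forall>a \<in> set (type_of_p_group p (primary_component p G)). a \<le> r) \<longleftrightarrow>
    (\<forall>x k. x \<in> carrier G \<longrightarrow> x [^]\<^bsub>G\<^esub> (p ^ k :: nat) = \<one>\<^bsub>G\<^esub> \<longrightarrow> x [^]\<^bsub>G\<^esub> (p ^ r) = \<one>\<^bsub>G\<^esub>)"
    (is "?L \<longleftrightarrow> ?R")
proof -
  interpret G: comm_group G by fact
  define P where "P = primary_component p G"
  have P: "comm_group P" "finite (carrier P)"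
    unfolding P_def primary_component_def using G(2)
    by (auto intro: G.comm_group_subgroup G.subgroup_primary_component)
  then have gP: "group P" using comm_group.axioms(2) by blast
  have mem: "x \<in> carrier P \<longleftrightarrow> x \<in> carrier G \<and> (\<exists>k::nat. x [^]\<^bsub>G\<^esub> (p ^ k) = \<one>\<^bsub>G\<^esub>)" for x
    unfolding P_def primary_component_def by simp
  have pow: "x [^]\<^bsub>P\<^esub> (n::nat) = x [^]\<^bsub>G\<^esub> n" "\<one>\<^bsub>P\<^esub> = \<one>\<^bsub>G\<^esub>" for x n
    unfolding P_def primary_component_def by (auto simp: nat_pow_carrier_update)
  have "\<exists>k::nat. x [^]\<^bsub>P\<^esub> (p ^ k) = \<one>\<^bsub>P\<^esub>" if "x \<in> carrier P" for x
    using that unfolding mem pow by blast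
  then obtain as where as: "is_partition as" "P \<cong> group_of_type p as"
    using finite_p_group_iso_group_of_type[OF p P] by blast
  have gt: "group (group_of_type p as)" using comm_group_group_of_type comm_group.axioms(2) by blast
  have type: "type_of_p_group p P = as" using type_of_p_group_eqI[OF p gP as] .
  have as': "\<And>j. j \<in> {..<length as} \<Longrightarrow> prime p \<and> as ! j \<ge> 1"
    using as(1) p by (simp add: is_partition_nth)
  have "?R \<longleftrightarrow> primary_exponents_le r P"
  proof
    assume ?R
    show "primary_exponents_le r P" unfolding primary_exponents_le_def pow
    proof (intro allI impI)
      fix q k :: nat and x assume q: "prime q" and x: "x \<in> carrier P" and e: "x [^]\<^bsub>G\<^esub> (q ^ k) = \<one>\<^bsub>G\<^esub>"
      then have xG: "x \<in> carrier G" and xr: "x [^]\<^bsub>G\<^esub> (p ^ r) = \<one>\<^bsub>G\<^esub>" using \<open>?R\<close> mem by auto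
      show "x [^]\<^bsub>G\<^esub> (q ^ r) = \<one>\<^bsub>G\<^esub>"
      proof (cases "q = p")
        \<comment> \<open>An element killed by powers of two distinct primes has order 1.\<close>
        case False
        have "G.ord x dvd q ^ k" "G.ord x dvd p ^ r" using e xr xG G.pow_eq_id by auto
        moreover have "coprime (q ^ k) (p ^ r)" using False p q by (simp add: primes_coprime)
        ultimately have "G.ord x = 1" by (metis coprime_common_divisor nat_dvd_1_iff_1)
        then show ?thesis using xG G.pow_eq_id by simp
      qed (use xr in simp)
    qed
  next
    assume "primary_exponents_le r P"
    then show ?R using p mem unfolding primary_exponents_le_def pow by blast
  qed
  also have "\<dots> \<longleftrightarrow> primary_exponents_le r (group_of_type p as)"
    by (rule iso_primary_exponents_le[OF gP gt as(2)])
  also have "\<dots> \<longleftrightarrow> (\<forall>j\<in>{..<length as}. as ! j \<le> r)"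
    unfolding group_of_type_eq_primary_product by (rule primary_exponents_le_primary_product[OF as'])
  also have "\<dots> \<longleftrightarrow> ?L" using type unfolding P_def by (auto simp: all_set_conv_all_nth)
  finally show ?thesis by blast
qed

section \<open>The rank of the conjugate group\<close>

lemma homs_eq_on_generate:
  assumes "group G" "group H" "h \<in> hom G H" "k \<in> hom G H" "T \<subseteq> carrier G"
    and eq: "\<And>x. x \<in> T \<Longrightarrow> h x = k x" and x: "x \<in> generate G T"
  shows "h x = k x"
proof -
  interpret h: group_hom G H h using assms by (simp add: group_hom_def group_hom_axioms_def)
  interpret k: group_hom G H k using assms by (simp add: group_hom_def group_hom_axioms_def)
  show ?thesis using x
  proof (induction rule: generate.induct)
    case one then show ?case by simp
  next
    case (incl x) then show ?case using eq by blast
  next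
    case (inv x)
    then have "x \<in> carrier G" using assms(5) by blast
    then show ?case using eq[OF inv] by simp
  next
    case (eng x y)
    then have "x \<in> carrier G" "y \<in> carrier G" using h.G.generate_in_carrier[OF assms(5)] by blast+
    then show ?case using eng by simp
  qed
qed

lemma pow_product_group:
  "x [^]\<^bsub>product_group I G\<^esub> (n::nat) = (\<lambda>i\<in>I. x i [^]\<^bsub>G i\<^esub> n)"
  by (induction n) (auto simp: nat_pow_def intro!: restrict_ext)

lemma carrier_group_of_type:
  assumes "prime p"
  shows "carrier (group_of_type p as) = (\<Pi>\<^sub>E i\<in>{..<length as}. {0..<int (p ^ (as ! i))})"
  unfolding group_of_type_eq_primary_product using assms by (rule carrier_primary_product)

lemma unit_vector_in_group_of_type:
  assumes "prime p" "\<forall>b\<in>set as. 0 < b"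
  shows "unit_vector {..<length as} i \<in> carrier (group_of_type p as)"
  unfolding group_of_type_eq_primary_product
  using assms by (intro unit_vector_in_primary_product) (auto simp: Suc_le_eq)

text \<open>A counting form of the bound by the dimension of \<open>Q\<close> modulo
  \<open>p\<close>: there are at least \<open>p ^ m\<close> homomorphisms to \<int>/p, and at most
  \<open>p ^ card T\<close> assignments of values on generators.\<close>

lemma length_le_card_generators:
  assumes S: "p \<in> S" "\<And>q. q \<in> S \<Longrightarrow> prime q" "\<And>q b. q \<in> S \<Longrightarrow> b \<in> set (B q) \<Longrightarrow> 0 < b"
    and T: "finite T" "T \<subseteq> carrier (product_group S (\<lambda>q. group_of_type q (B q)))"
    and gen: "generate (product_group S (\<lambda>q. group_of_type q (B q))) T = carrier (product_group S (\<lambda>q. group_of_type q (B q)))"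
  shows "length (B p) \<le> card T"
proof -
  define Q where "Q = product_group S (\<lambda>q. group_of_type q (B q))"
  define m where "m = length (B p)"
  have p: "prime p" using S by blast
  have p1: "int p > 1" using p prime_gt_1_nat by force
  have Q: "group Q" unfolding Q_def
    by (intro product_group comm_group.axioms(2)[OF comm_group_group_of_type])
  \<comment> \<open>The \<open>\<psi> c\<close> are \<open>p ^ m\<close> distinct homomorphisms to \<open>\<int>/p\<close>; each is determined by its values on \<open>T\<close>.\<close>
  define \<psi> where "\<psi> c f = (\<Sum>i<m. c i * f p i) mod int p" for c :: "nat \<Rightarrow> int" and f :: "nat \<Rightarrow> nat \<Rightarrow> int"
  have hom: "\<psi> c \<in> hom Q (integer_mod_group p)" for c
  proof (rule homI)
    fix x show "\<psi> c x \<in> carrier (integer_mod_group p)"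
      using p1 by (simp add: \<psi>_def carrier_integer_mod_group)
  next
    fix x y
    have "\<psi> c (x \<otimes>\<^bsub>Q\<^esub> y) = (\<Sum>i<m. c i * ((x p i + y p i) mod int (p ^ (B p ! i)))) mod int p"
      unfolding \<psi>_def Q_def using S(1) by (simp add: group_of_type_def m_def del: of_nat_power)
    also have "\<dots> = (\<Sum>i<m. (c i * ((x p i + y p i) mod int (p ^ (B p ! i)))) mod int p) mod int p"
      by (simp only: mod_sum_eq)
    \<comment> \<open>Parts are positive, so \<open>p\<close> divides each modulus and the reduction
      made by the group law is invisible modulo \<open>p\<close>.\<close>
    also have "\<dots> = (\<Sum>i<m. (c i * (x p i + y p i)) mod int p) mod int p"
    proof (rule arg_cong[of _ _ "\<lambda>t. t mod int p"], rule sum.cong[OF refl])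
      fix i assume "i \<in> {..<m}"
      then have "0 < B p ! i" using S by (simp add: m_def)
      then have "int p dvd int (p ^ (B p ! i))" by (simp add: dvd_power)
      then show "(c i * ((x p i + y p i) mod int (p ^ (B p ! i)))) mod int p = (c i * (x p i + y p i)) mod int p"
        by (metis mod_mod_cancel mod_mult_right_eq)
    qed
    also have "\<dots> = ((\<Sum>i<m. c i * x p i) + (\<Sum>i<m. c i * y p i)) mod int p"
      by (simp only: mod_sum_eq distrib_left sum.distrib)
    finally show "\<psi> c (x \<otimes>\<^bsub>Q\<^esub> y) = \<psi> c x \<otimes>\<^bsub>integer_mod_group p\<^esub> \<psi> c y"
      by (simp add: \<psi>_def mod_add_eq)
  qed
  \<comment> \<open>A unit vector at the prime \<open>p\<close> and zero at all others: evaluating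
    at \<open>e i\<close> reads off \<open>c i\<close>, so different \<open>c\<close> give different
    homomorphisms.\<close>
  define e where "e i = (\<lambda>q\<in>S. if q = p then unit_vector {..<m} i else (\<lambda>j\<in>{..<length (B q)}. 0))" for i
  have eQ: "e i \<in> carrier Q" for i
    unfolding Q_def e_def using S unit_vector_in_group_of_type[of p "B p" i]
    by (auto simp: m_def carrier_group_of_type prime_gt_0_nat)
  have \<psi>e: "\<psi> c (e i) = c i" if "c \<in> (\<Pi>\<^sub>E i\<in>{..<m}. {0..<int p})" "i < m" for c i
  proof -
    have "(\<Sum>j<m. c j * e i p j) = (\<Sum>j<m. if j = i then c j else 0)"
      using S(1) by (intro sum.cong) (auto simp: e_def unit_vector_def)
    also have "\<dots> = c i" using that(2) by simp
    finally show ?thesis unfolding \<psi>_def using that by (auto simp: PiE_iff)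
  qed
  have "inj_on (\<lambda>c. \<lambda>t\<in>T. \<psi> c t) (\<Pi>\<^sub>E i\<in>{..<m}. {0..<int p})"
  proof (rule inj_onI)
    fix c d assume c: "c \<in> (\<Pi>\<^sub>E i\<in>{..<m}. {0..<int p})" and d: "d \<in> (\<Pi>\<^sub>E i\<in>{..<m}. {0..<int p})"
      and eq: "(\<lambda>t\<in>T. \<psi> c t) = (\<lambda>t\<in>T. \<psi> d t)"
    have eqT: "\<psi> c t = \<psi> d t" if "t \<in> T" for t using fun_cong[OF eq, of t] that by simp
    have "\<psi> c f = \<psi> d f" if "f \<in> carrier Q" for f
      using homs_eq_on_generate[OF Q group_integer_mod_group hom hom, of T c d f] eqT T(2) gen that
      unfolding Q_def by blast
    then have "c i = d i" if "i < m" for i using \<psi>e[OF c that] \<psi>e[OF d that] eQ[of i] by metis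
    then show "c = d" using PiE_ext[OF c d] by blast
  qed
  moreover have "(\<lambda>c. \<lambda>t\<in>T. \<psi> c t) ` (\<Pi>\<^sub>E i\<in>{..<m}. {0..<int p}) \<subseteq> (\<Pi>\<^sub>E t\<in>T. {0..<int p})"
  proof (intro image_subsetI)
    fix c
    have "\<psi> c t \<in> {0..<int p}" for t using p1 by (simp add: \<psi>_def)
    then show "(\<lambda>t\<in>T. \<psi> c t) \<in> (\<Pi>\<^sub>E t\<in>T. {0..<int p})" by (simp only: restrict_PiE_iff) blast
  qed
  ultimately have "card (\<Pi>\<^sub>E i\<in>{..<m}. {0..<int p}) \<le> card (\<Pi>\<^sub>E t\<in>T. {0..<int p})"
    using T(1) by (intro card_inj_on_le finite_PiE) auto
  then have "p ^ m \<le> p ^ card T" using T(1) by (simp add: card_PiE)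
  then show ?thesis unfolding m_def using p1 by (metis of_nat_1 of_nat_less_iff power_le_imp_le_exp)
qed

text \<open>The \<open>i\<close>-th generator is the \<open>i\<close>-th unit vector at all primes
  simultaneously. Its powers attain any prescribed entries, because the moduli at different primes
  are coprime.\<close>

lemma generating_set_of_length:
  assumes S: "finite S" "\<And>q. q \<in> S \<Longrightarrow> prime q" "\<And>q b. q \<in> S \<Longrightarrow> b \<in> set (B q) \<Longrightarrow> 0 < b"
    and len: "\<And>q. q \<in> S \<Longrightarrow> length (B q) \<le> r"
  shows "\<exists>T \<subseteq> carrier (product_group S (\<lambda>q. group_of_type q (B q))). finite T \<and> card T \<le> r \<and>
    generate (product_group S (\<lambda>q. group_of_type q (B q))) T = carrier (product_group S (\<lambda>q. group_of_type q (B q)))"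
proof -
  define Q where "Q = product_group S (\<lambda>q. group_of_type q (B q))"
  interpret Q: group Q unfolding Q_def
    by (intro product_group comm_group.axioms(2)[OF comm_group_group_of_type])
  \<comment> \<open>At a prime \<open>q\<close> with at most \<open>i\<close> parts this vector is
    zero.\<close>
  define e where "e i = (\<lambda>q\<in>S. unit_vector {..<length (B q)} i)" for i
  have eQ: "e i \<in> carrier Q" for i
    unfolding Q_def e_def using S(2,3) by (auto intro!: unit_vector_in_group_of_type)
  define T where "T = e ` {..<r}"
  have T: "T \<subseteq> carrier Q" "finite T" "card T \<le> r"
    unfolding T_def using eQ card_image_le[of "{..<r}" e] by auto
  have "f \<in> generate Q T" if f: "f \<in> carrier Q" for f
  proof -
    \<comment> \<open>Truncation of \<open>f\<close> to its first \<open>k\<close> coordinates at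
      every prime: \<open>F 0\<close> is the identity, and \<open>F r = f\<close> because no prime
      has more than \<open>r\<close> parts.\<close>
    define F where "F k = (\<lambda>q\<in>S. \<lambda>j\<in>{..<length (B q)}. if j < k then f q j else 0)" for k
    have fq: "f q \<in> (\<Pi>\<^sub>E i\<in>{..<length (B q)}. {0..<int (q ^ (B q ! i))})" if "q \<in> S" for q
      using f that unfolding Q_def carrier_group_of_type[OF S(2)[OF that], symmetric] by auto
    have "k \<le> r \<Longrightarrow> F k \<in> generate Q T" for k
    proof (induction k)
      case 0
      have "F 0 = \<one>\<^bsub>Q\<^esub>" by (simp add: F_def Q_def group_of_type_def)
      then show ?case using generate.one by metis
    next
      case (Suc k)
      define A where "A = {q \<in> S. k < length (B q)}"
      \<comment> \<open>One exponent \<open>n\<close> sets coordinate \<open>k\<close> at all primes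
        that have it; the entries are nonnegative, so \<open>nat\<close> loses nothing.\<close>
      have "\<exists>n. \<forall>q\<in>A. [n = nat (f q k)] (mod (q ^ (B q ! k)))"
        using S(1,2) by (intro chinese_remainder_nat) (auto simp: A_def primes_coprime)
      then obtain n where n: "\<And>q. q \<in> A \<Longrightarrow> [n = nat (f q k)] (mod (q ^ (B q ! k)))" by blast
      have nf: "int n mod int (q ^ (B q ! k)) = f q k" if "q \<in> A" for q
      proof -
        have "n mod q ^ (B q ! k) = nat (f q k) mod q ^ (B q ! k)" using n[OF that] by (simp add: cong_def)
        then have "int n mod int (q ^ (B q ! k)) = int (nat (f q k)) mod int (q ^ (B q ! k))"
          by (metis of_nat_mod)
        then show ?thesis using fq[of q] that by (auto simp: A_def PiE_iff)
      qed
      have "F (Suc k) = F k \<otimes>\<^bsub>Q\<^esub> (e k [^]\<^bsub>Q\<^esub> n)"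
      proof (intro ext)
        fix q j
        show "F (Suc k) q j = (F k \<otimes>\<^bsub>Q\<^esub> (e k [^]\<^bsub>Q\<^esub> n)) q j"
        proof (cases "q \<in> S \<and> j < length (B q)")
          case True
          then have fr: "0 \<le> f q j" "f q j < int (q ^ (B q ! j))" using fq[of q] by (auto simp: PiE_iff simp del: of_nat_power)
          have "(F k \<otimes>\<^bsub>Q\<^esub> (e k [^]\<^bsub>Q\<^esub> n)) q j = ((if j < k then f q j else 0) + (if j = k then int n else 0)) mod int (q ^ (B q ! j))"
            using True by (simp add: Q_def pow_product_group group_of_type_def F_def e_def unit_vector_def mod_simps)
          also have "\<dots> = F (Suc k) q j"
            using True nf[of q] fr by (auto simp: A_def F_def less_Suc_eq simp del: of_nat_power)
          finally show ?thesis by simp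
        next
          case False
          then show ?thesis by (auto simp: Q_def F_def group_of_type_def)
        qed
      qed
      moreover have "e k \<in> T" using Suc unfolding T_def by auto
      then have "e k [^]\<^bsub>Q\<^esub> n \<in> generate Q T"
        using Q.subgroup_int_pow_closed[OF Q.generate_is_subgroup[OF T(1)] generate.incl, of "e k" "int n"]
        by (simp add: int_pow_int)
      ultimately show ?case using Suc generate.eng by (metis Suc_leD)
    qed
    then have "F r \<in> generate Q T" by blast
    moreover have "F r = f"
    proof (intro ext)
      fix q j
      show "F r q j = f q j"
      proof (cases "q \<in> S")
        case True
        then show ?thesis using len[OF True] fq[OF True] by (auto simp: F_def PiE_iff extensional_def)
      next
        case False
        then show ?thesis using f by (auto simp: F_def Q_def PiE_iff extensional_def)
      qed
    qed
    ultimately show ?thesis by simp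
  qed
  then have "generate Q T = carrier Q" using Q.generate_in_carrier[OF T(1)] by blast
  then show ?thesis using T unfolding Q_def by blast
qed

lemma group_rank_product_of_p_groups:
  assumes S: "finite S" "\<And>q. q \<in> S \<Longrightarrow> prime q" "\<And>q b. q \<in> S \<Longrightarrow> b \<in> set (B q) \<Longrightarrow> 0 < b"
  shows "group_rank (product_group S (\<lambda>q. group_of_type q (B q))) \<le> r \<longleftrightarrow> (\<forall>q\<in>S. length (B q) \<le> r)"
proof -
  define Q where "Q = product_group S (\<lambda>q. group_of_type q (B q))"
  define P where "P k \<longleftrightarrow> (\<exists>T. T \<subseteq> carrier Q \<and> finite T \<and> card T = k \<and> generate Q T = carrier Q)" for k
  have rank: "group_rank Q = (LEAST k. P k)" unfolding group_rank_def P_def ..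
  \<comment> \<open>Any common bound provides some finite generating set, so the
    \<open>LEAST\<close> in the rank is attained.\<close>
  obtain N where N: "\<And>q. q \<in> S \<Longrightarrow> length (B q) \<le> N"
    using S(1) finite_nat_set_iff_bounded_le[of "(\<lambda>q. length (B q)) ` S"] by auto
  have "\<exists>k. P k" using generating_set_of_length[of S B N] S N unfolding P_def Q_def by blast
  then have "P (group_rank Q)" unfolding rank by (rule LeastI_ex)
  then obtain T where T: "T \<subseteq> carrier Q" "finite T" "card T = group_rank Q" "generate Q T = carrier Q"
    unfolding P_def by blast
  show ?thesis
  proof
    assume "group_rank (product_group S (\<lambda>q. group_of_type q (B q))) \<le> r"
    moreover have "length (B q) \<le> card T" if "q \<in> S" for q
      using length_le_card_generators[of q S B T] that S T unfolding Q_def by blast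
    ultimately show "\<forall>q\<in>S. length (B q) \<le> r" using T(3) unfolding Q_def by fastforce
  next
    assume "\<forall>q\<in>S. length (B q) \<le> r"
    then obtain T where "T \<subseteq> carrier Q" "finite T" "card T \<le> r" "generate Q T = carrier Q"
      using generating_set_of_length[of S B r] S unfolding Q_def by blast
    then have "P (card T)" "card T \<le> r" unfolding P_def by blast+
    then have "group_rank Q \<le> r" unfolding rank using Least_le le_trans by blast
    then show "group_rank (product_group S (\<lambda>q. group_of_type q (B q))) \<le> r" unfolding Q_def .
  qed
qed

lemma length_conjugate_partition: "length (conjugate_partition as) = Max (insert 0 (set as))"
  by (simp add: conjugate_partition_def)

text \<open>The index \<open>j\<close> runs from 1 to the largest part \<open>M\<close>, so
  \<open>M\<close> is a genuine part and survives every filter.\<close>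

lemma conjugate_partition_pos:
  assumes "b \<in> set (conjugate_partition as)" shows "0 < b"
proof -
  define M where "M = Max (insert 0 (set as))"
  obtain j where j: "1 \<le> j" "j \<le> M" "b = length (filter (\<lambda>a. j \<le> a) as)"
    using assms unfolding conjugate_partition_def M_def by auto
  have "M \<in> insert 0 (set as)" unfolding M_def by (rule Max_in) auto
  then have "M \<in> set (filter (\<lambda>a. j \<le> a) as)" using j by auto
  then show ?thesis unfolding j(3) by (metis length_pos_if_in_set)
qed

text \<open>The rank of a product over distinct primes is governed by the longest type, and the
  length of a conjugate partition is the largest part of the original one.\<close>

theorem group_rank_conjugate_group_le_iff:
  assumes G: "comm_group G" "finite (carrier G)"
  shows "group_rank (conjugate_group G) \<le> r \<longleftrightarrow> primary_exponents_le r G"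
proof -
  interpret G: comm_group G by fact
  define S where "S = {p. prime p \<and> p dvd order G}"
  have "order G > 0" using G(2) by (simp add: G.order_gt_0_iff_finite)
  then have S: "finite S" "\<And>q. q \<in> S \<Longrightarrow> prime q" unfolding S_def
    by (auto intro: finite_subset[of _ "{..order G}"] dest: dvd_imp_le)
  define as where "as p = type_of_p_group p (primary_component p G)" for p
  have "group_rank (conjugate_group G) \<le> r \<longleftrightarrow> (\<forall>p\<in>S. length (conjugate_partition (as p)) \<le> r)"
    unfolding conjugate_group_def conjugate_p_group_def S_def[symmetric] as_def[symmetric]
    by (rule group_rank_product_of_p_groups) (use S conjugate_partition_pos in auto)
  also have "\<dots> \<longleftrightarrow> (\<forall>p\<in>S. \<forall>a\<in>set (as p). a \<le> r)"
    by (simp add: length_conjugate_partition)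
  also have "\<dots> \<longleftrightarrow> (\<forall>p\<in>S. \<forall>x k. x \<in> carrier G \<longrightarrow> x [^]\<^bsub>G\<^esub> (p ^ k :: nat) = \<one>\<^bsub>G\<^esub> \<longrightarrow> x [^]\<^bsub>G\<^esub> (p ^ r) = \<one>\<^bsub>G\<^esub>)"
    unfolding as_def using S(2) type_of_primary_component[OF _ G] by blast
  also have "\<dots> \<longleftrightarrow> primary_exponents_le r G"
  proof
    assume L: "\<forall>p\<in>S. \<forall>x k. x \<in> carrier G \<longrightarrow> x [^]\<^bsub>G\<^esub> (p ^ k :: nat) = \<one>\<^bsub>G\<^esub> \<longrightarrow> x [^]\<^bsub>G\<^esub> (p ^ r) = \<one>\<^bsub>G\<^esub>"
    show "primary_exponents_le r G" unfolding primary_exponents_le_def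
    proof (intro allI impI)
      fix p k :: nat and x assume p: "prime p" and x: "x \<in> carrier G" "x [^]\<^bsub>G\<^esub> (p ^ k) = \<one>\<^bsub>G\<^esub>"
      show "x [^]\<^bsub>G\<^esub> (p ^ r) = \<one>\<^bsub>G\<^esub>"
      proof (cases "p \<in> S")
        case True then show ?thesis using L x by blast
      next
        \<comment> \<open>The conjugate involves only primes dividing the order; at any other prime,
          elements of \<open>p\<close>-power order are trivial by Lagrange.\<close>
        case False
        then have "coprime p (order G)" using p unfolding S_def by (simp add: prime_imp_coprime)
        then have "coprime (p ^ k) (order G)" by simp
        moreover have "G.ord x dvd p ^ k" "G.ord x dvd order G"
          using x G.pow_eq_id G.ord_dvd_group_order by auto
        ultimately have "G.ord x = 1" by (metis coprime_common_divisor nat_dvd_1_iff_1)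
        then show ?thesis using x G.pow_eq_id by simp
      qed
    qed
  next
    assume "primary_exponents_le r G"
    then show "\<forall>p\<in>S. \<forall>x k. x \<in> carrier G \<longrightarrow> x [^]\<^bsub>G\<^esub> (p ^ k :: nat) = \<one>\<^bsub>G\<^esub> \<longrightarrow> x [^]\<^bsub>G\<^esub> (p ^ r) = \<one>\<^bsub>G\<^esub>"
      using S(2) unfolding primary_exponents_le_def by blast
  qed
  finally show ?thesis .
qed

section \<open>Isomorphism classes and tuples of positive integers\<close>

text \<open>The triple \<open>(k, p, i)\<close> names the \<open>i\<close>-th copy of \<int>/p^k.
  Thus \<open>g k\<close> encodes, by unique factorization, how many copies there are for each
  prime.\<close>

definition model_index :: "nat \<Rightarrow> (nat \<Rightarrow> nat) \<Rightarrow> (nat \<times> nat \<times> nat) set" where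
  "model_index r g = (SIGMA k:{1..r}. SIGMA p:prime_factors (g k). {..<multiplicity p (g k)})"

definition model :: "nat \<Rightarrow> (nat \<Rightarrow> nat) \<Rightarrow> (nat \<times> nat \<times> nat \<Rightarrow> int) monoid" where
  "model r g = primary_product (model_index r g) (\<lambda>(k, p, i). p) (\<lambda>(k, p, i). k)"

lemma finite_model_index: "finite (model_index r g)"
  unfolding model_index_def by (intro finite_SigmaI) auto

lemma prime_model_index: "(k, p, i) \<in> model_index r g \<Longrightarrow> prime p \<and> 1 \<le> k \<and> k \<le> r"
  unfolding model_index_def by auto

lemma model_index_cases:
  assumes "j \<in> model_index r g"
  shows "prime (case j of (k, p, i) \<Rightarrow> p)" "1 \<le> (case j of (k, p, i) \<Rightarrow> k)" "(case j of (k, p, i) \<Rightarrow> k) \<le> r"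
  using assms by (auto simp: model_index_def)

lemma card_model_index:
  assumes "prime p" "1 \<le> t"
  shows "card {j \<in> model_index r g. (case j of (k, p, i) \<Rightarrow> p) = p \<and> (case j of (k, p, i) \<Rightarrow> k) = t}
    = (if t \<le> r then multiplicity p (g t) else 0)"
proof (cases "t \<le> r")
  case True
  have "{j \<in> model_index r g. (case j of (k, p, i) \<Rightarrow> p) = p \<and> (case j of (k, p, i) \<Rightarrow> k) = t}
      = (\<lambda>i. (t, p, i)) ` {..<multiplicity p (g t)}"
    using True assms unfolding model_index_def by (auto simp: prime_factors_multiplicity)
  then show ?thesis using True by (simp add: card_image inj_on_def)
next
  case False
  then have "{j \<in> model_index r g. (case j of (k, p, i) \<Rightarrow> p) = p \<and> (case j of (k, p, i) \<Rightarrow> k) = t} = {}"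
    unfolding model_index_def by auto
  then show ?thesis using False by (simp only: card.empty if_False)
qed

lemma comm_group_model: "comm_group (model r g)"
  unfolding model_def by (rule comm_group_primary_product)

lemma group_model: "group (model r g)"
  using comm_group_model comm_group.axioms(2) by blast

lemma finite_model: "finite (carrier (model r g))"
  unfolding model_def by (intro finite_primary_product finite_model_index) (simp add: model_index_cases)

lemma order_model:
  assumes "\<And>k. 1 \<le> k \<Longrightarrow> k \<le> r \<Longrightarrow> g k > 0"
  shows "order (model r g) = (\<Prod>k=1..r. g k ^ k)"
proof -
  have "order (model r g) = (\<Prod>(k, p, i)\<in>model_index r g. p ^ k)"
    unfolding model_def
    by (subst order_primary_product[OF finite_model_index]) (auto intro: prod.cong dest: prime_model_index)
  also have "\<dots> = (\<Prod>k=1..r. \<Prod>p\<in>prime_factors (g k). \<Prod>i<multiplicity p (g k). p ^ k)"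
    unfolding model_index_def by (subst prod.Sigma | simp)+
  also have "\<dots> = (\<Prod>k=1..r. (\<Prod>p\<in>prime_factors (g k). p ^ multiplicity p (g k)) ^ k)"
    by (simp add: prod_power_distrib flip: power_mult) (simp add: mult.commute)
  also have "\<dots> = (\<Prod>k=1..r. g k ^ k)"
    using assms by (intro prod.cong refl) (simp add: prod_prime_factors)
  finally show ?thesis .
qed

lemma primary_exponents_le_model: "primary_exponents_le r (model r g)"
  unfolding model_def by (subst primary_exponents_le_primary_product) (simp_all add: model_index_cases[unfolded One_nat_def])

text \<open>Extensional functions, so that a tuple is determined by its entries and isomorphic
  models have equal tuples.\<close>

definition positive_tuples :: "nat \<Rightarrow> (nat \<Rightarrow> nat) set" where
  "positive_tuples r = (\<Pi>\<^sub>E k\<in>{1..r}. {1..})"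

lemma model_iso_imp_eq:
  assumes g: "g \<in> positive_tuples r" and h: "h \<in> positive_tuples r" and iso: "model r g \<cong> model r h"
  shows "g = h"
proof (rule PiE_ext)
  show "g \<in> (\<Pi>\<^sub>E k\<in>{1..r}. {1..})" "h \<in> (\<Pi>\<^sub>E k\<in>{1..r}. {1..})"
    using g h unfolding positive_tuples_def by auto
  fix t assume t: "t \<in> {1..r}"
  have "multiplicity p (g t) = multiplicity p (h t)" if p: "prime p" for p
  proof -
    have "1 \<le> t" "t \<le> r" using t by auto
    have "card {j \<in> model_index r g. (case j of (k, p, i) \<Rightarrow> p) = p \<and> (case j of (k, p, i) \<Rightarrow> k) = t}
        = card {j \<in> model_index r h. (case j of (k, p, i) \<Rightarrow> p) = p \<and> (case j of (k, p, i) \<Rightarrow> k) = t}"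
      by (rule iso_primary_product_multiplicities[OF finite_model_index _ finite_model_index _
            iso[unfolded model_def] p \<open>1 \<le> t\<close>]) (erule model_index_cases(1))+
    then show ?thesis using \<open>t \<le> r\<close> unfolding card_model_index[OF p \<open>1 \<le> t\<close>] by simp
  qed
  moreover have "g t \<noteq> 0" "h t \<noteq> 0" using g h t unfolding positive_tuples_def by (auto dest: PiE_mem)
  ultimately show "g t = h t" by (metis multiplicity_eq_nat neq0_conv)
qed

text \<open>The product defining \<open>g k\<close> runs over all factors with exponent
  \<open>k\<close>, repetitions included, so the multiplicity of \<open>p\<close> in it counts the
  copies of \<int>/p^k. The exponent bound leaves no factor outside \<open>1..r\<close>.\<close>

lemma iso_model:
  assumes G: "comm_group G" "finite (carrier G)" and le: "primary_exponents_le r G"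
  shows "\<exists>g\<in>positive_tuples r. G \<cong> model r g"
proof -
  have gG: "group G" using G comm_group.axioms(2) by blast
  obtain n \<pi> \<kappa> where d: "\<And>j. j<n \<Longrightarrow> prime (\<pi> j) \<and> \<kappa> j \<ge> 1" and iso: "G \<cong> primary_product {..<n::nat} \<pi> \<kappa>"
    using finite_comm_group_iso_primary_product[OF G] by blast
  have gP: "group (primary_product {..<n::nat} \<pi> \<kappa>)" using comm_group_primary_product comm_group.axioms(2) by blast
  have "primary_exponents_le r (primary_product {..<n} \<pi> \<kappa>)"
    using le iso_primary_exponents_le[OF gG gP iso] by blast
  then have \<kappa>r: "\<And>j. j < n \<Longrightarrow> \<kappa> j \<le> r"
    using primary_exponents_le_primary_product[of "{..<n}" \<pi> \<kappa> r] d by blast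
  define g where "g = (\<lambda>k\<in>{1..r}. \<Prod>j\<in>{j \<in> {..<n}. \<kappa> j = k}. \<pi> j)"
  have pos: "\<pi> j > 0" if "j < n" for j using d[OF that] prime_gt_0_nat by blast
  have g: "g \<in> positive_tuples r" unfolding g_def positive_tuples_def
    using pos by (auto simp: Suc_le_eq intro!: prod_pos)
  have mult: "multiplicity p (g t) = card {j \<in> {..<n}. \<pi> j = p \<and> \<kappa> j = t}" if p: "prime p" and t: "t \<in> {1..r}" for p t
  proof -
    have "multiplicity p (g t) = (\<Sum>j\<in>{j \<in> {..<n}. \<kappa> j = t}. multiplicity p (\<pi> j))"
    proof -
      have "g t = (\<Prod>j\<in>{j \<in> {..<n}. \<kappa> j = t}. \<pi> j)" unfolding g_def using t by simp
      moreover have "0 \<notin> \<pi> ` {j \<in> {..<n}. \<kappa> j = t}" using pos by fastforce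
      ultimately show ?thesis using p by (simp add: prime_elem_multiplicity_prod_distrib)
    qed
    also have "\<dots> = (\<Sum>j\<in>{j \<in> {..<n}. \<kappa> j = t}. if \<pi> j = p then 1 else 0)"
      using d p by (intro sum.cong refl) (auto simp: prime_multiplicity_other)
    also have "\<dots> = card {j \<in> {j \<in> {..<n}. \<kappa> j = t}. \<pi> j = p}"
      by (simp add: sum.If_cases Int_def)
    also have "{j \<in> {j \<in> {..<n}. \<kappa> j = t}. \<pi> j = p} = {j \<in> {..<n}. \<pi> j = p \<and> \<kappa> j = t}" by blast
    finally show ?thesis .
  qed
  have "primary_product {..<n} \<pi> \<kappa> \<cong> model r g" unfolding model_def
  proof (rule iso_primary_product_of_multiplicities)
    fix p t :: nat assume p: "prime p" and t: "1 \<le> t"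
    show "card {j \<in> {..<n}. \<pi> j = p \<and> \<kappa> j = t}
      = card {j \<in> model_index r g. (case j of (k, p, i) \<Rightarrow> p) = p \<and> (case j of (k, p, i) \<Rightarrow> k) = t}"
    proof (cases "t \<le> r")
      case True
      then show ?thesis unfolding card_model_index[OF p t] using mult[OF p, of t] t by simp
    next
      case False
      then have "{j \<in> {..<n}. \<pi> j = p \<and> \<kappa> j = t} = {}" using \<kappa>r by auto
      then show ?thesis unfolding card_model_index[OF p t] using False by (simp only: card.empty if_False)
    qed
  next
    show "prime (case j of (k, p, i) \<Rightarrow> p) \<and> 1 \<le> (case j of (k, p, i) \<Rightarrow> k)" if "j \<in> model_index r g" for j
      using model_index_cases[OF that] by blast
  qed (use d finite_model_index in auto)
  then show ?thesis using g iso iso_trans by blast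
qed

section \<open>Isomorphism classes and their representatives\<close>

lemma equiv_fin_ab_iso: "equiv fin_ab_groups fin_ab_iso"
proof (rule equivI)
  show "fin_ab_iso \<subseteq> fin_ab_groups \<times> fin_ab_groups" unfolding fin_ab_iso_def by auto
  show "refl_on fin_ab_groups fin_ab_iso" unfolding refl_on_def fin_ab_iso_def by auto
  show "sym fin_ab_iso"
    unfolding sym_def fin_ab_iso_def fin_ab_groups_def using group.iso_sym comm_group.axioms(2) by blast
  show "trans fin_ab_iso" unfolding trans_def fin_ab_iso_def using iso_trans by blast
qed

lemma representative_class:
  assumes "C \<in> fin_ab_classes"
  shows "representative C \<in> C" "comm_group (representative C)" "group (representative C)" "finite (carrier (representative C))"
    "C = fin_ab_iso `` {representative C}"
proof -
  have "C \<noteq> {}" using assms in_quotient_imp_non_empty[OF equiv_fin_ab_iso] unfolding fin_ab_classes_def by blast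
  then show rep: "representative C \<in> C" unfolding representative_def by (metis ex_in_conv someI_ex)
  have "C \<subseteq> fin_ab_groups" using assms in_quotient_imp_subset[OF equiv_fin_ab_iso] unfolding fin_ab_classes_def by blast
  then have G: "representative C \<in> fin_ab_groups" using rep by blast
  then show "comm_group (representative C)" "group (representative C)" "finite (carrier (representative C))"
    unfolding fin_ab_groups_def using comm_group.axioms(2) by auto
  obtain A where A: "A \<in> fin_ab_groups" "C = fin_ab_iso `` {A}"
    using assms unfolding fin_ab_classes_def by (rule quotientE)
  then have "(A, representative C) \<in> fin_ab_iso" using rep by blast
  then show "C = fin_ab_iso `` {representative C}" using A equiv_class_eq[OF equiv_fin_ab_iso] by blast
qed

lemma class_eqI:
  assumes "C \<in> fin_ab_classes" "D \<in> fin_ab_classes" "representative C \<cong> representative D"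
  shows "C = D"
proof -
  have "(representative C, representative D) \<in> fin_ab_iso"
    using representative_class(2,4)[OF assms(1)] representative_class(2,4)[OF assms(2)] assms(3)
    unfolding fin_ab_iso_def fin_ab_groups_def by blast
  then show ?thesis
    using representative_class(5)[OF assms(1)] representative_class(5)[OF assms(2)] equiv_class_eq[OF equiv_fin_ab_iso] by metis
qed

lemma iso_nat_monoid:
  assumes G: "comm_group G" "finite (carrier G)"
  shows "\<exists>H \<in> fin_ab_groups. G \<cong> H"
proof -
  interpret G: comm_group G by fact
  obtain f :: "'a \<Rightarrow> nat" where f: "inj_on f (carrier G)"
    using finite_imp_inj_to_nat_seg[OF G(2)] by blast
  define g where "g = inv_into (carrier G) f"
  have gf: "g (f x) = x" if "x \<in> carrier G" for x unfolding g_def using f that by simp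
  define H where "H = \<lparr>carrier = f ` carrier G, monoid.mult = (\<lambda>x y. f (g x \<otimes>\<^bsub>G\<^esub> g y)), one = f \<one>\<^bsub>G\<^esub>\<rparr>"
  have iso: "f \<in> iso G H"
    using f by (auto simp: iso_def hom_def bij_betw_def H_def gf)
  have "comm_group (H\<lparr>one := f \<one>\<^bsub>G\<^esub>\<rparr>)" using G.iso_imp_img_comm_group[OF iso] .
  then have "comm_group H" by (simp add: H_def)
  moreover have "finite (carrier H)" using G(2) by (simp add: H_def)
  ultimately show ?thesis using iso is_isoI unfolding fin_ab_groups_def by blast
qed

lemma class_exists:
  assumes G: "comm_group G" "finite (carrier G)"
  shows "\<exists>C \<in> fin_ab_classes. G \<cong> representative C"
proof -
  obtain H where H: "H \<in> fin_ab_groups" "G \<cong> H" using iso_nat_monoid[OF G] by blast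
  have C: "fin_ab_iso `` {H} \<in> fin_ab_classes" unfolding fin_ab_classes_def using H(1) by (rule quotientI)
  then have "H \<cong> representative (fin_ab_iso `` {H})"
    using representative_class(1)[OF C] unfolding fin_ab_iso_def by blast
  then show ?thesis using C H(2) iso_trans by blast
qed

text \<open>Accepts groups of any type, since models and direct products do not have natural numbers
  as elements.\<close>

definition iso_class :: "('a, 'b) monoid_scheme \<Rightarrow> nat monoid set" where
  "iso_class G = (SOME C. C \<in> fin_ab_classes \<and> G \<cong> representative C)"

lemma iso_class:
  assumes "comm_group G" "finite (carrier G)"
  shows "iso_class G \<in> fin_ab_classes" "G \<cong> representative (iso_class G)"
  using someI_ex[OF class_exists[OF assms, unfolded Bex_def]] unfolding iso_class_def by auto

lemma iso_class_eqI:
  assumes "comm_group G" "finite (carrier G)" "C \<in> fin_ab_classes" "G \<cong> representative C"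
  shows "iso_class G = C"
proof (rule class_eqI)
  have "representative (iso_class G) \<cong> G"
    using group.iso_sym[OF comm_group.axioms(2)[OF assms(1)]] iso_class[OF assms(1,2)] by blast
  then show "representative (iso_class G) \<cong> representative C" using assms(4) iso_trans by blast
qed (use iso_class assms in auto)

definition bounded_classes :: "nat \<Rightarrow> nat monoid set set" where
  "bounded_classes r = {C \<in> fin_ab_classes. primary_exponents_le r (representative C)}"

lemma order_iso: "G \<cong> H \<Longrightarrow> order G = order H"
  unfolding order_def by (rule iso_same_card)

lemma bij_iso_class_model: "bij_betw (\<lambda>g. iso_class (model r g)) (positive_tuples r) (bounded_classes r)"
  unfolding bij_betw_def
proof (intro conjI equalityI subsetI inj_onI)
  fix g h assume g: "g \<in> positive_tuples r" and h: "h \<in> positive_tuples r"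
    and eq: "iso_class (model r g) = iso_class (model r h)"
  have "representative (iso_class (model r h)) \<cong> model r h"
    using group.iso_sym[OF group_model] iso_class(2)[OF comm_group_model finite_model] by blast
  then have "model r g \<cong> model r h"
    using eq iso_class(2)[OF comm_group_model finite_model, of r g] iso_trans by metis
  then show "g = h" using model_iso_imp_eq g h by blast
next
  fix C assume "C \<in> (\<lambda>g. iso_class (model r g)) ` positive_tuples r"
  then obtain g where C: "C = iso_class (model r g)" by blast
  have "C \<in> fin_ab_classes" "model r g \<cong> representative C"
    unfolding C using iso_class[OF comm_group_model finite_model] by auto
  then show "C \<in> bounded_classes r"
    using iso_primary_exponents_le[OF group_model _ \<open>model r g \<cong> _\<close>] primary_exponents_le_model representative_class(3)
    unfolding bounded_classes_def by blast
next
  fix C assume "C \<in> bounded_classes r"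
  then have C: "C \<in> fin_ab_classes" "primary_exponents_le r (representative C)" unfolding bounded_classes_def by auto
  obtain g where g: "g \<in> positive_tuples r" "representative C \<cong> model r g"
    using iso_model[OF representative_class(2,4)[OF C(1)] C(2)] by blast
  have "model r g \<cong> representative C" using group.iso_sym[OF representative_class(3)[OF C(1)] g(2)] .
  then have "iso_class (model r g) = C" using iso_class_eqI[OF comm_group_model finite_model C(1)] by blast
  then show "C \<in> (\<lambda>g. iso_class (model r g)) ` positive_tuples r" using g(1) by blast
qed

section \<open>Counting decompositions by order\<close>

definition weighted_product :: "nat \<Rightarrow> (nat \<Rightarrow> nat) \<Rightarrow> nat" where
  "weighted_product r g = (\<Prod>k=1..r. g k ^ k)"

lemma order_iso_class_model:
  assumes "g \<in> positive_tuples r"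
  shows "order (representative (iso_class (model r g))) = weighted_product r g"
proof -
  have "order (model r g) = weighted_product r g" unfolding weighted_product_def
    using assms by (intro order_model) (auto simp: positive_tuples_def PiE_iff Suc_le_eq)
  then show ?thesis using order_iso[OF iso_class(2)[OF comm_group_model finite_model, of r g]] by simp
qed

text \<open>Every entry of such a tuple divides \<open>n\<close>. Divisibility in place of equality
  lets the bound apply to each member of a pair with product \<open>n\<close>.\<close>

lemma finite_weighted_product_dvd:
  assumes "n > 0"
  shows "finite {g \<in> positive_tuples r. weighted_product r g dvd n}"
proof (rule finite_subset)
  show "{g \<in> positive_tuples r. weighted_product r g dvd n} \<subseteq> (\<Pi>\<^sub>E k\<in>{1..r}. {1..n})"
  proof
    fix g assume g: "g \<in> {g \<in> positive_tuples r. weighted_product r g dvd n}"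
    have "g k \<le> n" if k: "k \<in> {1..r}" for k
    proof -
      have "g k dvd g k ^ k" using k by (simp add: dvd_power)
      also have "g k ^ k dvd weighted_product r g" unfolding weighted_product_def using k by (intro dvd_prodI) auto
      finally have "g k dvd n" using g dvd_trans by blast
      then show ?thesis using assms by (rule dvd_imp_le)
    qed
    then show "g \<in> (\<Pi>\<^sub>E k\<in>{1..r}. {1..n})" using g unfolding positive_tuples_def by (auto simp: PiE_iff)
  qed
qed (intro finite_PiE, auto)

lemma comm_group_DirProd:
  assumes "comm_group G" "comm_group H"
  shows "comm_group (G \<times>\<times> H)"
  by (rule group.group_comm_groupI)
    (use assms in \<open>auto intro: DirProd_group comm_group.axioms(2) comm_groupE(4)\<close>)

text \<open>The map \<open>q\<close> sends a pair of classes to the class of its product. The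
  decompositions of \<open>C\<close> form the fibre of \<open>q\<close> over \<open>C\<close>, so
  the sum over \<open>X\<close> counts \<open>Y\<close>, which corresponds to pairs of
  tuples.\<close>

theorem direct_factor_sum_eq_card:
  assumes n: "n > 0"
  shows "direct_factor_sum r n =
    card {(g, h) \<in> positive_tuples r \<times> positive_tuples r. weighted_product r g * weighted_product r h = n}"
proof -
  define D where "D = bounded_classes r"
  define o' where "o' C = order (representative C)" for C
  define m where "m g = iso_class (model r g)" for g
  define X where "X = {C \<in> D. o' C = n}"
  define Y where "Y = {(A, B) \<in> D \<times> D. o' A * o' B = n}"
  define Z where "Z = {(g, h) \<in> positive_tuples r \<times> positive_tuples r. weighted_product r g * weighted_product r h = n}"
  define F where "F C = {(A, B). A \<in> fin_ab_classes \<and> B \<in> fin_ab_classes \<and>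
      representative C \<cong> representative A \<times>\<times> representative B}" for C
  define q where "q = (\<lambda>(A, B). iso_class (representative A \<times>\<times> representative B))"
  have bij: "bij_betw m (positive_tuples r) D" unfolding m_def D_def by (rule bij_iso_class_model)
  have om: "o' (m g) = weighted_product r g" if "g \<in> positive_tuples r" for g
    unfolding o'_def m_def using that by (rule order_iso_class_model)
  have Df: "C \<in> fin_ab_classes" if "C \<in> D" for C using that unfolding D_def bounded_classes_def by blast
  have "Z \<subseteq> {g \<in> positive_tuples r. weighted_product r g dvd n} \<times> {g \<in> positive_tuples r. weighted_product r g dvd n}"
    unfolding Z_def by auto
  then have "finite Z" using finite_weighted_product_dvd[OF n] by (meson finite_SigmaI finite_subset)
  have "bij_betw (map_prod m m) Z Y"
  proof -
    have inj: "inj_on m (positive_tuples r)" and im: "m ` positive_tuples r = D" using bij unfolding bij_betw_def by auto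
    have "inj_on (map_prod m m) Z"
      unfolding Z_def by (rule inj_onI) (auto dest: inj_onD[OF inj])
    moreover have "map_prod m m ` Z = Y"
    proof (intro equalityI subsetI)
      fix y assume "y \<in> map_prod m m ` Z"
      then show "y \<in> Y" using om im unfolding Z_def Y_def by auto
    next
      fix y assume "y \<in> Y"
      then obtain A B where y: "y = (A, B)" "A \<in> D" "B \<in> D" "o' A * o' B = n" unfolding Y_def by blast
      then obtain g h where gh: "g \<in> positive_tuples r" "h \<in> positive_tuples r" "A = m g" "B = m h" using im by blast
      then have "(g, h) \<in> Z" using y om unfolding Z_def by simp
      then show "y \<in> map_prod m m ` Z" using y gh by (metis image_eqI map_prod_simp)
    qed
    ultimately show ?thesis unfolding bij_betw_def by blast
  qed
  then have Y: "finite Y" "card Y = card Z" using \<open>finite Z\<close> bij_betw_finite bij_betw_same_card by metis+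
  have X: "finite X"
  proof (rule finite_subset)
    show "X \<subseteq> m ` {g \<in> positive_tuples r. weighted_product r g dvd n}"
      using bij om unfolding X_def bij_betw_def by auto
  qed (use finite_weighted_product_dvd[OF n] in blast)
  have AB: "comm_group (representative A \<times>\<times> representative B)" "finite (carrier (representative A \<times>\<times> representative B))"
    "group (representative A \<times>\<times> representative B)"
    if "A \<in> fin_ab_classes" "B \<in> fin_ab_classes" for A B
    using representative_class[OF that(1)] representative_class[OF that(2)]
    by (auto intro: comm_group_DirProd DirProd_group)
  have ord: "order (representative A \<times>\<times> representative B) = o' A * o' B" for A B
    unfolding o'_def order_def by (simp add: card_cartesian_product)
  have le: "primary_exponents_le r (representative A \<times>\<times> representative B) \<longleftrightarrow> A \<in> D \<and> B \<in> D"
    if "A \<in> fin_ab_classes" "B \<in> fin_ab_classes" for A B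
    using primary_exponents_le_DirProd[OF representative_class(3)[OF that(1)] representative_class(3)[OF that(2)]] that
    unfolding D_def bounded_classes_def by blast
  have q: "q (A, B) \<in> fin_ab_classes" "representative A \<times>\<times> representative B \<cong> representative (q (A, B))"
    if "A \<in> fin_ab_classes" "B \<in> fin_ab_classes" for A B
    unfolding q_def using iso_class[OF AB(1,2)[OF that]] by auto
  have qX: "q ` Y \<subseteq> X"
  proof
    fix C assume "C \<in> q ` Y"
    then obtain A B where y: "C = q (A, B)" "A \<in> D" "B \<in> D" "o' A * o' B = n" unfolding Y_def by blast
    note c = Df[OF y(2)] Df[OF y(3)]
    have "primary_exponents_le r (representative C)"
      using iso_primary_exponents_le[OF AB(3)[OF c] representative_class(3)[OF q(1)[OF c]] q(2)[OF c]] le[OF c] y by blast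
    moreover have "o' C = n" using order_iso[OF q(2)[OF c]] ord y unfolding o'_def by simp
    ultimately show "C \<in> X" using q(1)[OF c] y unfolding X_def D_def bounded_classes_def by blast
  qed
  \<comment> \<open>The count for \<open>C\<close> allows arbitrary classes \<open>A\<close> and
    \<open>B\<close>; the bound on \<open>C\<close> itself puts both in \<open>D\<close>.\<close>
  have F: "F C = {y \<in> Y. q y = C}" if C: "C \<in> X" for C
  proof (intro equalityI subsetI)
    have Cf: "C \<in> fin_ab_classes" and Cle: "primary_exponents_le r (representative C)" and Cn: "o' C = n"
      using C unfolding X_def D_def bounded_classes_def by auto
    note gC = representative_class(3)[OF Cf]
    {
      fix y assume "y \<in> F C"
      then obtain A B where y: "y = (A, B)" "A \<in> fin_ab_classes" "B \<in> fin_ab_classes"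
        and iso: "representative C \<cong> representative A \<times>\<times> representative B" unfolding F_def by blast
      have "A \<in> D \<and> B \<in> D"
        using iso_primary_exponents_le[OF gC AB(3)[OF y(2,3)] iso] le[OF y(2,3)] Cle by blast
      moreover have "o' A * o' B = n" using order_iso[OF iso] ord Cn unfolding o'_def by simp
      moreover have "q y = C" unfolding q_def y(1)
        using iso_class_eqI[OF AB(1,2)[OF y(2,3)] Cf group.iso_sym[OF gC iso]] by simp
      ultimately show "y \<in> {y \<in> Y. q y = C}" unfolding Y_def y(1) by blast
    next
      fix y assume "y \<in> {y \<in> Y. q y = C}"
      then obtain A B where y: "y = (A, B)" "A \<in> D" "B \<in> D" "q (A, B) = C" unfolding Y_def by blast
      note c = Df[OF y(2)] Df[OF y(3)]
      have "representative A \<times>\<times> representative B \<cong> representative C" using q(2)[OF c] y by simp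
      then have "representative C \<cong> representative A \<times>\<times> representative B" using group.iso_sym[OF AB(3)[OF c]] by blast
      then show "y \<in> F C" unfolding F_def y(1) using c by blast
    }
  qed
  have "{C \<in> fin_ab_classes. order (representative C) = n \<and> group_rank (conjugate_group (representative C)) \<le> r} = X"
    unfolding X_def D_def bounded_classes_def o'_def
    using group_rank_conjugate_group_le_iff representative_class(2,4) by blast
  then have "direct_factor_sum r n = (\<Sum>C\<in>X. card (F C))"
    unfolding direct_factor_sum_def num_direct_factors_def F_def by simp
  also have "\<dots> = (\<Sum>C\<in>X. \<Sum>y\<in>{y \<in> Y. q y = C}. 1)" using F by simp
  also have "\<dots> = (\<Sum>y\<in>Y. 1)" by (rule sum.group[OF Y(1) X qX])
  finally show ?thesis using Y(2) unfolding Z_def by simp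
qed

section \<open>Dirichlet series\<close>

definition zeta_term :: "complex \<Rightarrow> nat \<Rightarrow> nat \<Rightarrow> complex" where
  "zeta_term s k m = of_nat m powr (- (of_nat k * s))"

text \<open>Strict positivity of the norm sum is recorded because \<open>infsum\<close> is 0 on
  families that are not summable: a positive value will later prove summability.\<close>

lemma zeta_term_abs_summable:
  assumes "1 \<le> k" "Re s > 1"
  shows "(\<lambda>m. norm (zeta_term s k m)) summable_on {1..}" "infsum (zeta_term s k) {1..} = riemann_zeta (of_nat k * s)"
    "infsum (\<lambda>m. norm (zeta_term s k m)) {1..} > 0"
proof -
  have bij: "bij_betw Suc UNIV {1..}" by (rule bij_betwI[of _ _ _ "\<lambda>n. n - 1"]) auto
  have norm: "norm (zeta_term s k (Suc n)) = real (Suc n) powr (- (real k * Re s))" for n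
    unfolding zeta_term_def by (subst norm_powr_real_powr) auto
  have "real k * Re s > 1" using assms mult_le_less_imp_less[of 1 "real k" 1 "Re s"] by simp
  then have "summable (\<lambda>n. real n powr (- (real k * Re s)))" by (simp add: summable_real_powr_iff)
  then have sm: "summable (\<lambda>n. norm (zeta_term s k (Suc n)))" unfolding norm by (subst summable_Suc_iff)
  have "(\<lambda>n. norm (zeta_term s k (Suc n))) summable_on UNIV"
    using sm by (subst summable_on_UNIV_nonneg_real_iff) auto
  then show abs: "(\<lambda>m. norm (zeta_term s k m)) summable_on {1..}"
    using summable_on_reindex_bij_betw[OF bij, of "\<lambda>m. norm (zeta_term s k m)"] by simp
  have "((\<lambda>n. zeta_term s k (Suc n)) has_sum (\<Sum>n. zeta_term s k (Suc n))) UNIV"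
    using norm_summable_imp_has_sum[OF sm summable_sums[OF summable_norm_cancel[OF sm]]] .
  then have "(zeta_term s k has_sum (\<Sum>n. zeta_term s k (Suc n))) {1..}"
    using has_sum_reindex_bij_betw[OF bij, of "zeta_term s k"] by simp
  then show "infsum (zeta_term s k) {1..} = riemann_zeta (of_nat k * s)"
    unfolding riemann_zeta_def zeta_term_def[symmetric] by (rule infsumI)
  have "norm (zeta_term s k 1) = (\<Sum>\<^sub>\<infinity>m\<in>{1}. norm (zeta_term s k m))" by simp
  also have "\<dots> \<le> infsum (\<lambda>m. norm (zeta_term s k m)) {1..}"
    using abs by (intro infsum_mono2) auto
  finally show "infsum (\<lambda>m. norm (zeta_term s k m)) {1..} > 0" by (simp add: zeta_term_def)
qed

text \<open>Complex \<open>powr\<close> is not multiplicative in its base in general, but it is for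
  nonnegative real bases.\<close>

lemma of_nat_powr_prod:
  "finite A \<Longrightarrow> of_nat (\<Prod>a\<in>A. f a) powr z = (\<Prod>a\<in>A. of_nat (f a) powr (z :: complex))"
  by (induction A rule: finite_induct) (simp_all add: powr_times_real flip: of_nat_prod)

lemma zeta_term_eq_power: "m > 0 \<Longrightarrow> zeta_term s k m = of_nat (m ^ k) powr (- s)"
  unfolding zeta_term_def by (induction k) (simp_all add: powr_times_real powr_add algebra_simps powr_diff powr_minus field_simps)

lemma positive_tuples_dirichlet_series:
  fixes r :: nat and s :: complex
  assumes "Re s > 1"
  defines "G \<equiv> \<lambda>g. of_nat (weighted_product r g) powr (- s)"
  shows "(\<lambda>g. norm (G g)) summable_on positive_tuples r"
    "(G has_sum (\<Prod>k=1..r. riemann_zeta (of_nat k * s))) (positive_tuples r)"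
proof -
  have G: "G g = (\<Prod>k=1..r. zeta_term s k (g k))" if "g \<in> positive_tuples r" for g
  proof -
    have "G g = (\<Prod>k=1..r. of_nat (g k ^ k) powr (- s))"
      unfolding G_def weighted_product_def by (rule of_nat_powr_prod) simp
    also have "\<dots> = (\<Prod>k=1..r. zeta_term s k (g k))"
      using that by (intro prod.cong refl zeta_term_eq_power[symmetric]) (auto simp: positive_tuples_def PiE_iff Suc_le_eq)
    finally show ?thesis .
  qed
  have "infsum (\<lambda>g. norm (G g)) (positive_tuples r) = infsum (\<lambda>g. \<Prod>k=1..r. norm (zeta_term s k (g k))) (positive_tuples r)"
    by (intro infsum_cong) (simp add: G prod_norm)
  also have "\<dots> = (\<Prod>k=1..r. infsum (\<lambda>m. norm (zeta_term s k m)) {1..})"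
    unfolding positive_tuples_def using zeta_term_abs_summable(1) assms(1) by (intro infsum_prod_PiE_abs) auto
  also have "\<dots> > 0" using zeta_term_abs_summable(3) assms(1) by (intro prod_pos) auto
  \<comment> \<open>A family without a sum would have \<open>infsum\<close> 0, against the positive
    product just found.\<close>
  finally show abs: "(\<lambda>g. norm (G g)) summable_on positive_tuples r" using infsum_not_exists by force
  have "infsum G (positive_tuples r) = infsum (\<lambda>g. \<Prod>k=1..r. zeta_term s k (g k)) (positive_tuples r)"
    by (intro infsum_cong G)
  also have "\<dots> = (\<Prod>k=1..r. infsum (zeta_term s k) {1..})"
    unfolding positive_tuples_def using zeta_term_abs_summable(1) assms(1) by (intro infsum_prod_PiE_abs) auto
  also have "\<dots> = (\<Prod>k=1..r. riemann_zeta (of_nat k * s))"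
    using zeta_term_abs_summable(2) assms(1) by (intro prod.cong) auto
  finally show "(G has_sum (\<Prod>k=1..r. riemann_zeta (of_nat k * s))) (positive_tuples r)"
    using has_sum_infsum[OF abs_summable_summable[OF abs]] by simp
qed

lemma weighted_product_pos: "g \<in> positive_tuples r \<Longrightarrow> weighted_product r g > 0"
  unfolding weighted_product_def by (intro prod_pos) (auto simp: positive_tuples_def PiE_iff Suc_le_eq)

theorem theorem1:
  fixes r :: nat and s :: complex
  assumes "r \<ge> 1" and "Re s > 1"
  shows "(\<lambda>n. of_nat (direct_factor_sum r (Suc n)) * of_nat (Suc n) powr (-s)) sums
           (\<Prod>k=1..r. riemann_zeta (of_nat k * s) ^ 2)"
proof -
  define E where "E = positive_tuples r"
  define G where "G g = of_nat (weighted_product r g) powr (- s)" for g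
  define Z where "Z = (\<Prod>k=1..r. riemann_zeta (of_nat k * s))"
  define W where "W = (\<lambda>(g, h). weighted_product r g * weighted_product r h)"
  \<comment> \<open>The shift by one matches the series, whose \<open>n\<close>-th term belongs to
    the order \<open>Suc n\<close>.\<close>
  define N where "N n = {x \<in> E \<times> E. W x = Suc n}" for n
  have abs: "(\<lambda>g. norm (G g)) summable_on E" and sum: "(G has_sum Z) E"
    using positive_tuples_dirichlet_series[OF assms(2), of r] unfolding E_def G_def Z_def by auto
  \<comment> \<open>The norms factor, so each inner sum is a multiple of one finite sum; absolute
    convergence gives the product \<open>Z * Z\<close> as a sum over pairs, free to be
    regrouped.\<close>
  have "(\<lambda>x. norm (case x of (g, h) \<Rightarrow> G g * G h)) summable_on E \<times> E"
    unfolding Infinite_Sum.abs_summable_on_Sigma_iff using abs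
    by (auto simp: norm_mult infsum_cmult_right' abs_mult infsum_nonneg intro: summable_on_cmult_left summable_on_cmult_right)
  then have "(\<lambda>(g, h). G g * G h) summable_on E \<times> E" by (rule abs_summable_summable)
  then have "((\<lambda>(g, h). G g * G h) has_sum Z * Z) (E \<times> E)"
    by (intro has_sum_SigmaI[where g = "\<lambda>g. G g * Z"]) (auto intro: has_sum_cmult_left has_sum_cmult_right sum)
  moreover have "(\<lambda>(g, h). G g * G h) = (\<lambda>x. of_nat (W x) powr (- s))"
    by (auto simp: fun_eq_iff G_def W_def powr_times_real)
  ultimately have hs: "((\<lambda>x. of_nat (W x) powr (- s)) has_sum Z * Z) (E \<times> E)" by simp
  \<comment> \<open>\<open>W x\<close> is positive, so each pair lies in the fibre with index
    \<open>W x - 1\<close> and in no other.\<close>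
  have bij: "bij_betw snd (Sigma UNIV N) (E \<times> E)"
  proof -
    have "W x > 0" if "x \<in> E \<times> E" for x
      using that weighted_product_pos unfolding W_def E_def by auto
    then have "x \<in> snd ` Sigma UNIV N" if "x \<in> E \<times> E" for x
      using that unfolding N_def by (intro image_eqI[of _ _ "(W x - 1, x)"]) auto
    then show ?thesis unfolding bij_betw_def inj_on_def N_def by auto
  qed
  have "((\<lambda>y. of_nat (W (snd y)) powr (- s)) has_sum Z * Z) (Sigma UNIV N)"
    using hs has_sum_reindex_bij_betw[OF bij, of "\<lambda>x. of_nat (W x) powr (- s)"] by blast
  \<comment> \<open>On a fibre the summand is constant and the fibre is finite, so its sum is the
    cardinality times that constant.\<close>
  moreover have "((\<lambda>x. of_nat (W (snd (n, x))) powr (- s)) has_sum of_nat (direct_factor_sum r (Suc n)) * of_nat (Suc n) powr (-s)) (N n)" for n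
  proof -
    have "N n \<subseteq> {g \<in> E. weighted_product r g dvd Suc n} \<times> {g \<in> E. weighted_product r g dvd Suc n}"
      unfolding N_def W_def by auto (metis dvd_triv_left dvd_triv_right)+
    then have "finite (N n)"
      using finite_weighted_product_dvd[of "Suc n" r] unfolding E_def by (meson finite_SigmaI finite_subset zero_less_Suc)
    moreover have "card (N n) = direct_factor_sum r (Suc n)"
      unfolding direct_factor_sum_eq_card[OF zero_less_Suc] N_def W_def E_def by (intro arg_cong[of _ _ card]) auto
    moreover have "(\<Sum>x\<in>N n. of_nat (W (snd (n, x))) powr (- s)) = (\<Sum>x\<in>N n. of_nat (Suc n) powr (- s))"
      unfolding N_def by (intro sum.cong) auto
    ultimately show ?thesis by (intro has_sum_finiteI) auto
  qed
  ultimately have "((\<lambda>n. of_nat (direct_factor_sum r (Suc n)) * of_nat (Suc n) powr (-s)) has_sum Z * Z) UNIV"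
    by (rule has_sum_SigmaD)
  then have "(\<lambda>n. of_nat (direct_factor_sum r (Suc n)) * of_nat (Suc n) powr (-s)) sums (Z * Z)"
    by (rule has_sum_imp_sums)
  then show ?thesis unfolding Z_def by (simp add: prod_power_distrib[symmetric] power2_eq_square prod.distrib)
qed

end
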